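(* For all finite multisets $\Gamma=[\varphi_1,\dots,\varphi_n]$, $\Delta=[\psi_1,\dots,\psi_m]$ of $\mathcal{L}_0$-formulas, the following are equivalent: (1) $\Gamma\vdash_{\mathcal{MV}}\Delta$; (2) $\Gamma\models^\ast_{\mathsf{M}}\Delta$; (3) $\Gamma\models^\ast_{\mathsf{I}}\Delta$, where $\mathsf{I}=\{\mathbb{M}\in\mathsf{M}: f=\mathrm{id}\}$.
   Context: $\mathcal{L}_0=\langle\wedge,\vee,\otimes,\to,1\rangle$ of type $\langle2,2,2,2,0\rangle$ (the language of commutative residuated lattices, product written $\otimes$). $\mathcal{MV}$ is the variety of MV-algebras in $\mathcal{L}_0$. $\Gamma\vdash_{\mathcal{MV}}\Delta$ iff $\mathcal{MV}\models\varphi_1\otimes\dots\otimes\varphi_n\leq\psi_1\otimes\dots\otimes\psi_m$ (empty product $=1$). $[\mathbf{0,1}]_{\mathrm{MV}}$ is the standard MV-algebra on $[0,1]$ in $\mathcal{L}_0$: $\wedge=\min$, $\vee=\max$, $x\otimes y=\max(0,x+y-1)$, $x\to y=\min(1,1-x+y)$, constant $1$. Finite multisets over a set form $A^\flat$ with sum $\uplus$; homomorphisms extend elementwise. For an $\mathcal{L}_0$-algebra $\mathbf{A}$ and a $\leqslant$-downset $F$ of $A^\flat$ (sub-multiset order), $\Gamma\models_{\langle\mathbf{A},F\rangle}\Delta$ means: for all $\mathfrak{C}\in A^\flat$ and homomorphisms $e\colon\mathbf{Fm}_{\mathcal{L}_0}\to\mathbf{A}$, $\mathfrak{C}\uplus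 e(\Gamma)\in F$ implies $\mathfrak{C}\uplus e(\Delta)\in F$. Let $\mathbf{D}=\langle[0,1],\sqsupseteq,\otimes,1\rangle$, with $\sqsubseteq$ the usual order of reals (so $\mathbf{D}$ is a dually integral Abelian pomonoid and $[a,1]$ is a downset of it). $\mathsf{M}$ is the class of all quadruples $\mathbb{M}=\langle[\mathbf{0,1}]_{\mathrm{MV}},\mathbf{D},[a,1],f\rangle$ where $a\in[0,1]$ and $f\colon[0,1]\to[0,1]$ is strictly monotone and preserves $\otimes$, extended to finite multisets by $f([a_1,\dots,a_k])=f(a_1)\otimes\dots\otimes f(a_k)$ ($f(\emptyset)=1$). For such $\mathbb{M}$, $\Gamma\models^\ast_{\mathbb{M}}\Delta$ iff $\Gamma\models_{\langle[\mathbf{0,1}]_{\mathrm{MV}},\{\mathfrak{X}\in[0,1]^\flat: f(\mathfrak{X})\in[a,1]\}\rangle}\Delta$; for a class, $\Gamma\models^\ast_{\mathsf{K}}\Delta$ iff this holds for every member. *)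

theory Defs
  imports Complex_Main "HOL-Algebra.Group" "HOL-Library.Multiset"
begin

text \<open>
  Algebras of type \<open>\<langle>\<and>, \<or>, \<otimes>, \<rightarrow>, 1\<rangle>\<close>; the product and the unit are those of the underlying
  \<^type>\<open>monoid_scheme\<close>.
\<close>

record 'a l0_algebra = "'a monoid" +
  meet :: "'a \<Rightarrow> 'a \<Rightarrow> 'a"
  join :: "'a \<Rightarrow> 'a \<Rightarrow> 'a"
  imp :: "'a \<Rightarrow> 'a \<Rightarrow> 'a"

definition l0_hom :: "'a l0_algebra \<Rightarrow> 'b l0_algebra \<Rightarrow> ('a \<Rightarrow> 'b) set" where
  "l0_hom A B = {h \<in> carrier A \<rightarrow> carrier B.
     (\<forall>x\<in>carrier A. \<forall>y\<in>carrier A.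
        h (meet A x y) = meet B (h x) (h y) \<and>
        h (join A x y) = join B (h x) (h y) \<and>
        h (x \<otimes>\<^bsub>A\<^esub> y) = h x \<otimes>\<^bsub>B\<^esub> h y \<and>
        h (imp A x y) = imp B (h x) (h y)) \<and>
     h \<one>\<^bsub>A\<^esub> = \<one>\<^bsub>B\<^esub>}"

definition l0_le :: "'a l0_algebra \<Rightarrow> 'a \<Rightarrow> 'a \<Rightarrow> bool" where
  "l0_le A x y \<longleftrightarrow> meet A x y = x"


datatype fm =
    Var nat
  | Meet fm fm
  | Join fm fm
  | Times fm fm
  | Imp fm fm
  | Unit

definition Fm :: "fm l0_algebra" where
  "Fm = \<lparr>carrier = UNIV, monoid.mult = Times, one = Unit, meet = Meet, join = Join, imp = Imp\<rparr>"


locale comm_residuated_lattice = comm_monoid A for A :: "'a l0_algebra" (structure) +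
  assumes meet_closed: "\<lbrakk>x \<in> carrier A; y \<in> carrier A\<rbrakk> \<Longrightarrow> meet A x y \<in> carrier A"
    and join_closed: "\<lbrakk>x \<in> carrier A; y \<in> carrier A\<rbrakk> \<Longrightarrow> join A x y \<in> carrier A"
    and imp_closed: "\<lbrakk>x \<in> carrier A; y \<in> carrier A\<rbrakk> \<Longrightarrow> imp A x y \<in> carrier A"
    and meet_comm: "\<lbrakk>x \<in> carrier A; y \<in> carrier A\<rbrakk> \<Longrightarrow> meet A x y = meet A y x"
    and join_comm: "\<lbrakk>x \<in> carrier A; y \<in> carrier A\<rbrakk> \<Longrightarrow> join A x y = join A y x"
    and meet_assoc: "\<lbrakk>x \<in> carrier A; y \<in> carrier A; z \<in> carrier A\<rbrakk>
      \<Longrightarrow> meet A (meet A x y) z = meet A x (meet A y z)"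
    and join_assoc: "\<lbrakk>x \<in> carrier A; y \<in> carrier A; z \<in> carrier A\<rbrakk>
      \<Longrightarrow> join A (join A x y) z = join A x (join A y z)"
    and meet_absorb: "\<lbrakk>x \<in> carrier A; y \<in> carrier A\<rbrakk> \<Longrightarrow> meet A x (join A x y) = x"
    and join_absorb: "\<lbrakk>x \<in> carrier A; y \<in> carrier A\<rbrakk> \<Longrightarrow> join A x (meet A x y) = x"
    and residuation: "\<lbrakk>x \<in> carrier A; y \<in> carrier A; z \<in> carrier A\<rbrakk>
      \<Longrightarrow> l0_le A (x \<otimes> y) z \<longleftrightarrow> l0_le A y (imp A x z)"

text \<open>
  MV-algebras are the bounded integral commutative residuated lattices satisfying
  \<open>(x \<rightarrow> y) \<rightarrow> y = x \<or> y\<close>. Since \<open>0\<close> is not in the signature, it enters only as the (unique) least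
  element, whose existence is required.
\<close>

locale mv_algebra = comm_residuated_lattice +
  assumes integral: "x \<in> carrier A \<Longrightarrow> l0_le A x \<one>"
    and bounded: "\<exists>z\<in>carrier A. \<forall>x\<in>carrier A. l0_le A z x"
    and imp_imp: "\<lbrakk>x \<in> carrier A; y \<in> carrier A\<rbrakk> \<Longrightarrow> imp A (imp A x y) y = join A x y"

text \<open>
  Validity in the class of MV-algebras. HOL cannot quantify over types inside a formula, so the
  algebras range over all carrier subsets of a type \<open>'a\<close> passed as a parameter.
  Every infinite \<open>'a\<close> yields the same relation: a refuted inequality is already refuted in a
  countable subalgebra, which has an isomorphic copy inside \<open>'a\<close>.
\<close>

definition MV_valid_le :: "'a itself \<Rightarrow> fm \<Rightarrow> fm \<Rightarrow> bool" where
  "MV_valid_le _ s t \<longleftrightarrow>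
     (\<forall>A :: 'a l0_algebra. mv_algebra A \<longrightarrow> (\<forall>e\<in>l0_hom Fm A. l0_le A (e s) (e t)))"

definition MV_entails :: "'a itself \<Rightarrow> fm multiset \<Rightarrow> fm multiset \<Rightarrow> bool" where
  "MV_entails T \<Gamma> \<Delta> \<longleftrightarrow>
     (\<forall>\<phi>s \<psi>s. mset \<phi>s = \<Gamma> \<longrightarrow> mset \<psi>s = \<Delta> \<longrightarrow>
        MV_valid_le T (foldr Times \<phi>s Unit) (foldr Times \<psi>s Unit))"


definition msets_over :: "'a set \<Rightarrow> 'a multiset set" where
  "msets_over S = {X. set_mset X \<subseteq> S}"

definition entails_matrix ::
    "'a l0_algebra \<Rightarrow> 'a multiset set \<Rightarrow> fm multiset \<Rightarrow> fm multiset \<Rightarrow> bool" where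
  "entails_matrix A F \<Gamma> \<Delta> \<longleftrightarrow>
     (\<forall>C\<in>msets_over (carrier A). \<forall>e\<in>l0_hom Fm A.
        C + image_mset e \<Gamma> \<in> F \<longrightarrow> C + image_mset e \<Delta> \<in> F)"

record 'd pomonoid = "'d monoid" +
  pole :: "'d \<Rightarrow> 'd \<Rightarrow> bool"

text \<open>
  The product of a finite multiset in a commutative monoid; by the lemma below the choice of the
  enumeration is irrelevant. (\<^const>\<open>fold_mset\<close> would need commutativity outside the carrier.)
\<close>

definition mset_prod :: "('d, 'm) monoid_scheme \<Rightarrow> 'd multiset \<Rightarrow> 'd" where
  "mset_prod G X = foldr (monoid.mult G) (SOME xs. mset xs = X) \<one>\<^bsub>G\<^esub>"

lemma (in comm_monoid) foldr_mult_closed: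
  "set xs \<subseteq> carrier G \<Longrightarrow> foldr (\<otimes>) xs \<one> \<in> carrier G"
  by (induction xs) auto

lemma (in comm_monoid) foldr_mult_move:
  assumes "set (us @ x # vs) \<subseteq> carrier G"
  shows "foldr (\<otimes>) (us @ x # vs) \<one> = x \<otimes> foldr (\<otimes>) (us @ vs) \<one>"
  using assms
proof (induction us)
  case (Cons u us)
  then show ?case
    using foldr_mult_closed[of "us @ vs"] by (simp add: m_lcomm)
qed simp

lemma (in comm_monoid) foldr_mult_cong_mset:
  assumes "mset xs = mset ys" "set xs \<subseteq> carrier G"
  shows "foldr (\<otimes>) xs \<one> = foldr (\<otimes>) ys \<one>"
  using assms
proof (induction xs arbitrary: ys)
  case (Cons x xs)
  then have "x \<in> set ys"
    by (metis list.set_intros(1) mset_eq_setD)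
  then obtain us vs where ys: "ys = us @ x # vs"
    by (meson split_list)
  have "set ys \<subseteq> carrier G"
    using Cons.prems mset_eq_setD by blast
  moreover have "mset xs = mset (us @ vs)"
    using Cons.prems(1) ys by simp
  ultimately show ?case
    using Cons.IH[of "us @ vs"] Cons.prems(2) ys foldr_mult_move[of us x vs] by simp
qed simp

lemma (in comm_monoid) mset_prod_mset:
  assumes "set xs \<subseteq> carrier G"
  shows "mset_prod G (mset xs) = foldr (\<otimes>) xs \<one>"
proof -
  have *: "mset (SOME ys. mset ys = mset xs) = mset xs"
    by (rule someI[of _ xs]) simp
  moreover have "set (SOME ys. mset ys = mset xs) \<subseteq> carrier G"
    using assms mset_eq_setD[OF *] by simp
  ultimately show ?thesis
    unfolding mset_prod_def by (rule foldr_mult_cong_mset)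
qed


text \<open>
  A quadruple \<open>\<langle>A, D, F, f\<rangle>\<close>: an algebra, a pomonoid, a downset of it, and a map between the
  carriers, extended to finite multisets through \<^const>\<open>mset_prod\<close>.
\<close>

type_synonym ('a, 'd) quadruple = "'a l0_algebra \<times> 'd pomonoid \<times> 'd set \<times> ('a \<Rightarrow> 'd)"

fun entails_star :: "('a, 'd) quadruple \<Rightarrow> fm multiset \<Rightarrow> fm multiset \<Rightarrow> bool" where
  "entails_star (A, D, F, f) \<Gamma> \<Delta> \<longleftrightarrow>
     entails_matrix A {X \<in> msets_over (carrier A). mset_prod D (image_mset f X) \<in> F} \<Gamma> \<Delta>"

definition entails_star_class ::
    "('a, 'd) quadruple set \<Rightarrow> fm multiset \<Rightarrow> fm multiset \<Rightarrow> bool" where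
  "entails_star_class K \<Gamma> \<Delta> \<longleftrightarrow> (\<forall>\<MM>\<in>K. entails_star \<MM> \<Gamma> \<Delta>)"

definition luk_prod :: "real \<Rightarrow> real \<Rightarrow> real" where
  "luk_prod x y = max 0 (x + y - 1)"

definition std_MV :: "real l0_algebra" where
  "std_MV = \<lparr>carrier = {0..1}, monoid.mult = luk_prod, one = 1,
     meet = min, join = max, imp = (\<lambda>x y. min 1 (1 - x + y))\<rparr>"

definition luk_D :: "real pomonoid" where
  "luk_D = \<lparr>carrier = {0..1}, monoid.mult = luk_prod, one = 1, pole = (\<lambda>x y. x \<ge> y)\<rparr>"

lemma mv_algebra_std_MV: "mv_algebra std_MV"
  by unfold_locales
    (auto simp: std_MV_def luk_prod_def l0_le_def min_def max_def split: if_splits)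

lemma comm_monoid_luk_D: "comm_monoid luk_D"
  by unfold_locales (auto simp: luk_D_def luk_prod_def max_def split: if_splits)

definition class_M :: "(real, real) quadruple set" where
  "class_M = {(std_MV, luk_D, {a..1}, f) | a f.
     a \<in> {0..1} \<and> f \<in> {0..1} \<rightarrow> {0..1} \<and> strict_mono_on {0..1} f \<and>
     (\<forall>x\<in>{0..1}. \<forall>y\<in>{0..1}. f (luk_prod x y) = luk_prod (f x) (f y))}"

definition class_I :: "(real, real) quadruple set" where
  "class_I = {(A, D, F, f) \<in> class_M. \<forall>x\<in>{0..1}. f x = x}"

end

theory Submission
  imports Defs "HOL-Algebra.FiniteProduct" "HOL-Library.Countable"
begin

text \<open>
  Everything reduces to Chang's completeness theorem: an inequality valid in \<open>[0, 1]\<close> holds in every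
  MV-algebra. If it fails in some MV-algebra, a filter maximal among those avoiding the witness of
  failure is prime, so it fails in a chain. A chain is the unit interval of an ordered abelian group,
  where the failure only involves finitely many elements and finitely many linear equations and strict
  inequalities between them. Fourier-Motzkin elimination turns a solution of such a system in an
  ordered group into a real one, hence into a refutation in \<open>[0, 1]\<close>.

  Conversely, a refutation in \<open>[0, 1]\<close> lives in a countable subalgebra. The relation for the class
  \<open>M\<close> follows from the inequality between products since the maps \<open>f\<close> are monotone homomorphisms of
  monoids, and the inequality is recovered from \<open>f = id\<close> by taking \<open>a\<close> to be the left-hand side.
\<close>

section \<open>Arithmetic in MV-algebras\<close>

text \<open>The group of a chain need not be Archimedean, so it may have no order embedding into the
  reals, and homomorphisms of the chain into [0,1] need not separate two given elements. Only the
  values of the subformulas of the failing inequality are moved, by a map that respects those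
  products and implications whose result is again such a value. Truncation keeps the operations from
  being linear, so pairs are sorted by whether their sum reaches the unit \<open>u\<close>. If it
  does, \<open>x + y = u + (x \<otimes> y)\<close> is imposed; if not, \<open>x + y < u\<close> is,
  which forces the real product to be truncated too. Strict monotonicity of the map keeps the
  inequality refuted. The absence of a constant 0 also leaves traces: negation and truncated sum
  rest on a chosen least element, and the subalgebra generated by a refutation in [0,1] may lack a
  least element until 0 is added as a generator.\<close>

context comm_residuated_lattice
begin

abbreviation le (infix "\<preceq>" 50) where "x \<preceq> y \<equiv> l0_le A x y"

declare meet_closed [simp, intro] join_closed [simp, intro] imp_closed [simp, intro]

lemma le_refl [simp]: "x \<in> carrier A \<Longrightarrow> x \<preceq> x"
  unfolding l0_le_def by (metis join_absorb meet_absorb meet_closed)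

lemma le_antisym: "\<lbrakk>x \<preceq> y; y \<preceq> x; x \<in> carrier A; y \<in> carrier A\<rbrakk> \<Longrightarrow> x = y"
  unfolding l0_le_def by (metis meet_comm)

lemma le_trans:
  "\<lbrakk>x \<preceq> y; y \<preceq> z; x \<in> carrier A; y \<in> carrier A; z \<in> carrier A\<rbrakk> \<Longrightarrow> x \<preceq> z"
  unfolding l0_le_def by (metis meet_assoc)

lemma meet_le1 [simp]: "\<lbrakk>x \<in> carrier A; y \<in> carrier A\<rbrakk> \<Longrightarrow> meet A x y \<preceq> x"
  unfolding l0_le_def by (metis le_refl l0_le_def meet_assoc meet_closed meet_comm)

lemma meet_le2 [simp]: "\<lbrakk>x \<in> carrier A; y \<in> carrier A\<rbrakk> \<Longrightarrow> meet A x y \<preceq> y"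
  by (metis meet_comm meet_le1)

lemma le_meetI:
  "\<lbrakk>z \<preceq> x; z \<preceq> y; x \<in> carrier A; y \<in> carrier A; z \<in> carrier A\<rbrakk> \<Longrightarrow> z \<preceq> meet A x y"
  unfolding l0_le_def by (metis meet_assoc)

lemma le_iff_join: "\<lbrakk>x \<in> carrier A; y \<in> carrier A\<rbrakk> \<Longrightarrow> x \<preceq> y \<longleftrightarrow> join A x y = y"
  unfolding l0_le_def by (metis join_absorb join_comm meet_absorb meet_comm)

lemma le_join1 [simp]: "\<lbrakk>x \<in> carrier A; y \<in> carrier A\<rbrakk> \<Longrightarrow> x \<preceq> join A x y"
  by (simp add: l0_le_def meet_absorb)

lemma le_join2 [simp]: "\<lbrakk>x \<in> carrier A; y \<in> carrier A\<rbrakk> \<Longrightarrow> y \<preceq> join A x y"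
  by (metis join_comm le_join1)

lemma join_leI:
  "\<lbrakk>x \<preceq> z; y \<preceq> z; x \<in> carrier A; y \<in> carrier A; z \<in> carrier A\<rbrakk> \<Longrightarrow> join A x y \<preceq> z"
  by (metis join_assoc join_closed le_iff_join)

lemma mult_imp_le: "\<lbrakk>x \<in> carrier A; y \<in> carrier A\<rbrakk> \<Longrightarrow> x \<otimes> imp A x y \<preceq> y"
  by (simp add: residuation)

lemma mult_mono_right:
  assumes "y \<preceq> z" "x \<in> carrier A" "y \<in> carrier A" "z \<in> carrier A"
  shows "x \<otimes> y \<preceq> x \<otimes> z"
proof -
  have "z \<preceq> imp A x (x \<otimes> z)"
    using assms residuation[of x z "x \<otimes> z"] by simp
  then show ?thesis
    using assms by (meson residuation le_trans imp_closed m_closed)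
qed

lemma mult_mono:
  assumes "x \<preceq> x'" "y \<preceq> y'"
    "x \<in> carrier A" "y \<in> carrier A" "x' \<in> carrier A" "y' \<in> carrier A"
  shows "x \<otimes> y \<preceq> x' \<otimes> y'"
  using mult_mono_right[of y y' x] mult_mono_right[of x x' y'] assms
  by (metis le_trans m_closed m_comm)

text \<open>By residuation both sides have the same elements below them, so antisymmetry identifies
  them.\<close>

lemma imp_imp_eq:
  assumes "x \<in> carrier A" "y \<in> carrier A" "z \<in> carrier A"
  shows "imp A x (imp A y z) = imp A (x \<otimes> y) z"
proof -
  have *: "t \<preceq> imp A x (imp A y z) \<longleftrightarrow> t \<preceq> imp A (x \<otimes> y) z" if "t \<in> carrier A" for t
    using that assms residuation[of x t "imp A y z"] residuation[of y "x \<otimes> t" z]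
      residuation[of "x \<otimes> y" t z] by (simp add: m_lcomm m_assoc)
  show ?thesis
    using *[of "imp A x (imp A y z)"] *[of "imp A (x \<otimes> y) z"] assms by (simp add: le_antisym)
qed

lemma imp_mono:
  assumes "x' \<preceq> x" "y \<preceq> y'"
    "x \<in> carrier A" "y \<in> carrier A" "x' \<in> carrier A" "y' \<in> carrier A"
  shows "imp A x y \<preceq> imp A x' y'"
proof -
  have "x' \<otimes> imp A x y \<preceq> x \<otimes> imp A x y"
    using assms by (simp add: mult_mono)
  then have "x' \<otimes> imp A x y \<preceq> y'"
    using assms by (meson le_trans mult_imp_le imp_closed m_closed)
  then show ?thesis
    using assms residuation by auto
qed

lemma one_imp [simp]: "x \<in> carrier A \<Longrightarrow> imp A \<one> x = x"
  using residuation[of \<one> x x] mult_imp_le[of \<one> x] by (simp add: le_antisym)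

end

section \<open>Negation, truncated sum, and the carry identities\<close>

context mv_algebra
begin

declare integral [simp]

lemma imp_eq_one_iff: "\<lbrakk>x \<in> carrier A; y \<in> carrier A\<rbrakk> \<Longrightarrow> imp A x y = \<one> \<longleftrightarrow> x \<preceq> y"
  by (metis integral imp_closed le_antisym le_refl one_closed r_one residuation)

lemma mult_le1 [simp]: "\<lbrakk>x \<in> carrier A; y \<in> carrier A\<rbrakk> \<Longrightarrow> x \<otimes> y \<preceq> x"
  using mult_mono_right[of y \<one> x] by simp

lemma mult_le2 [simp]: "\<lbrakk>x \<in> carrier A; y \<in> carrier A\<rbrakk> \<Longrightarrow> x \<otimes> y \<preceq> y"
  by (metis m_comm mult_le1)

definition bot where "bot = (SOME z. z \<in> carrier A \<and> (\<forall>x\<in>carrier A. z \<preceq> x))"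

lemma bot_closed [simp]: "bot \<in> carrier A" and bot_le [simp]: "x \<in> carrier A \<Longrightarrow> bot \<preceq> x"
proof -
  have "bot \<in> carrier A \<and> (\<forall>x\<in>carrier A. bot \<preceq> x)"
    unfolding bot_def by (rule someI_ex) (use bounded in blast)
  then show "bot \<in> carrier A" "x \<in> carrier A \<Longrightarrow> bot \<preceq> x" by auto
qed

lemma le_bot_iff: "x \<in> carrier A \<Longrightarrow> x \<preceq> bot \<longleftrightarrow> x = bot"
  by (metis bot_closed bot_le le_antisym)

lemma one_le_iff: "x \<in> carrier A \<Longrightarrow> \<one> \<preceq> x \<longleftrightarrow> x = \<one>"
  by (metis integral le_antisym le_refl one_closed)

lemma mult_bot [simp]: "x \<in> carrier A \<Longrightarrow> x \<otimes> bot = bot" "x \<in> carrier A \<Longrightarrow> bot \<otimes> x = bot"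
  by (metis bot_closed le_bot_iff m_closed mult_le1 mult_le2)+

definition neg where "neg x = imp A x bot"

lemma neg_closed [simp]: "x \<in> carrier A \<Longrightarrow> neg x \<in> carrier A"
  by (simp add: neg_def)

text \<open>The axiom \<open>imp_imp\<close> at \<open>bot\<close> reads
  \<open>neg (neg x) = join A x bot\<close>, and a join with the least element changes
  nothing.\<close>

lemma neg_neg [simp]: "x \<in> carrier A \<Longrightarrow> neg (neg x) = x"
  unfolding neg_def by (metis bot_closed bot_le imp_imp join_comm le_iff_join)

lemma neg_le_neg: "\<lbrakk>x \<preceq> y; x \<in> carrier A; y \<in> carrier A\<rbrakk> \<Longrightarrow> neg y \<preceq> neg x"
  by (simp add: neg_def imp_mono)

lemma neg_le_swap: "\<lbrakk>x \<in> carrier A; y \<in> carrier A\<rbrakk> \<Longrightarrow> neg x \<preceq> y \<longleftrightarrow> neg y \<preceq> x"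
  by (metis neg_closed neg_le_neg neg_neg)

lemma neg_bot [simp]: "neg bot = \<one>"
  by (simp add: neg_def imp_eq_one_iff)

lemma neg_one [simp]: "neg \<one> = bot"
  by (metis bot_closed neg_bot neg_neg)

text \<open>In [0,1] this is \<open>min 1 (x + y)\<close>; it is the addition from which the group
  of a chain is built.\<close>

definition plus (infixl "\<boxplus>" 65) where "x \<boxplus> y = neg (neg x \<otimes> neg y)"

lemma plus_closed [simp]: "\<lbrakk>x \<in> carrier A; y \<in> carrier A\<rbrakk> \<Longrightarrow> x \<boxplus> y \<in> carrier A"
  by (simp add: plus_def)

lemma plus_comm: "\<lbrakk>x \<in> carrier A; y \<in> carrier A\<rbrakk> \<Longrightarrow> x \<boxplus> y = y \<boxplus> x"
  by (simp add: plus_def m_comm)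

lemma plus_assoc:
  "\<lbrakk>x \<in> carrier A; y \<in> carrier A; z \<in> carrier A\<rbrakk> \<Longrightarrow> x \<boxplus> y \<boxplus> z = x \<boxplus> (y \<boxplus> z)"
  by (simp add: plus_def m_assoc)

lemma plus_lcomm:
  "\<lbrakk>x \<in> carrier A; y \<in> carrier A; z \<in> carrier A\<rbrakk> \<Longrightarrow> x \<boxplus> (y \<boxplus> z) = y \<boxplus> (x \<boxplus> z)"
  by (simp add: plus_def m_lcomm)

lemma plus_bot [simp]: "x \<in> carrier A \<Longrightarrow> x \<boxplus> bot = x" "x \<in> carrier A \<Longrightarrow> bot \<boxplus> x = x"
  by (simp_all add: plus_def)

lemma plus_one [simp]: "x \<in> carrier A \<Longrightarrow> x \<boxplus> \<one> = \<one>" "x \<in> carrier A \<Longrightarrow> \<one> \<boxplus> x = \<one>"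
  by (simp_all add: plus_def)

lemma neg_plus: "\<lbrakk>x \<in> carrier A; y \<in> carrier A\<rbrakk> \<Longrightarrow> neg (x \<boxplus> y) = neg x \<otimes> neg y"
  by (simp add: plus_def)

lemma neg_mult: "\<lbrakk>x \<in> carrier A; y \<in> carrier A\<rbrakk> \<Longrightarrow> neg (x \<otimes> y) = neg x \<boxplus> neg y"
  by (simp add: plus_def)

lemma imp_eq_plus: "\<lbrakk>x \<in> carrier A; y \<in> carrier A\<rbrakk> \<Longrightarrow> imp A x y = neg x \<boxplus> y"
  using imp_imp_eq[of x "neg y" bot] by (simp add: plus_def flip: neg_def)

lemma plus_eq_one_iff: "\<lbrakk>x \<in> carrier A; y \<in> carrier A\<rbrakk> \<Longrightarrow> x \<boxplus> y = \<one> \<longleftrightarrow> neg x \<preceq> y"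
  using imp_eq_one_iff[of "neg x" y] imp_eq_plus[of "neg x" y] by simp

lemma mult_eq_bot_iff: "\<lbrakk>x \<in> carrier A; y \<in> carrier A\<rbrakk> \<Longrightarrow> x \<otimes> y = bot \<longleftrightarrow> x \<preceq> neg y"
  using residuation[of y x bot] by (simp add: m_comm le_bot_iff neg_def)

lemma plus_mono:
  assumes "x \<preceq> x'" "y \<preceq> y'"
    "x \<in> carrier A" "y \<in> carrier A" "x' \<in> carrier A" "y' \<in> carrier A"
  shows "x \<boxplus> y \<preceq> x' \<boxplus> y'"
  unfolding plus_def using assms by (simp add: mult_mono neg_le_neg)

lemma le_plus1: "\<lbrakk>x \<in> carrier A; y \<in> carrier A\<rbrakk> \<Longrightarrow> x \<preceq> x \<boxplus> y"
  using plus_mono[of x x bot y] by simp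

text \<open>This is \<open>imp_imp\<close> with implication rewritten as a sum. As
  \<open>neg x \<otimes> y\<close> is the truncated difference \<open>y - x\<close>, adding
  \<open>x\<close> back gives the larger of the two.\<close>

lemma plus_neg_mult: "\<lbrakk>x \<in> carrier A; y \<in> carrier A\<rbrakk> \<Longrightarrow> x \<boxplus> (neg x \<otimes> y) = join A x y"
  using imp_imp[of y x]
  by (simp add: imp_eq_plus neg_plus join_comm plus_comm m_comm)

text \<open>The preceding identity for \<open>neg x\<close> and \<open>neg y\<close>, negated. That
  \<open>x\<close> cancels \<open>neg x\<close> in this way drives the carry identities
  below.\<close>

lemma mult_neg_plus_le:
  assumes "x \<in> carrier A" "y \<in> carrier A" "y \<preceq> x"
  shows "x \<otimes> (neg x \<boxplus> y) = y"
proof -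
  have "neg x \<boxplus> (x \<otimes> neg y) = neg y"
    using plus_neg_mult[of "neg x" "neg y"] le_iff_join[of "neg x" "neg y"] neg_le_neg[of y x] assms
    by simp
  then have "neg (neg x \<boxplus> (x \<otimes> neg y)) = y"
    using assms by simp
  then show ?thesis
    using assms by (simp add: neg_plus neg_mult)
qed

lemma plus_neg_mult_le: "\<lbrakk>x \<in> carrier A; y \<in> carrier A; x \<preceq> y\<rbrakk> \<Longrightarrow> x \<boxplus> (neg x \<otimes> y) = y"
  by (simp add: plus_neg_mult le_iff_join)

lemma mult_neg_plus:
  "\<lbrakk>x \<in> carrier A; y \<in> carrier A\<rbrakk> \<Longrightarrow> x \<otimes> (neg x \<boxplus> y) \<preceq> y"
  using mult_imp_le[of x y] by (simp add: imp_eq_plus)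

text \<open>Over the reals, \<open>a + b \<le> 1 \<le> b + c\<close> and both sides are
  \<open>a + b + c - 1\<close>: one of two neighbouring sums carries. Writing \<open>b\<close> as
  \<open>neg c \<boxplus> r\<close> with \<open>r = c \<otimes> b\<close> lets \<open>c\<close>
  cancel \<open>neg c\<close>, because \<open>a \<boxplus> r\<close> stays below
  \<open>c\<close>.\<close>

lemma plus_mult_exchange:
  assumes "a \<in> carrier A" "b \<in> carrier A" "c \<in> carrier A"
    and "a \<otimes> b = bot" "b \<boxplus> c = \<one>"
  shows "(a \<boxplus> b) \<otimes> c = a \<boxplus> (b \<otimes> c)"
proof -
  define r where "r = c \<otimes> b"
  have r: "r \<in> carrier A" using assms by (simp add: r_def)
  have "neg c \<preceq> b"
    using assms by (simp add: plus_eq_one_iff neg_le_swap)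
  then have b: "neg c \<boxplus> r = b"
    using plus_neg_mult_le[of "neg c" b] assms by (simp add: r_def)
  have "a \<boxplus> r \<preceq> neg b \<boxplus> r"
    using assms r by (simp add: plus_mono mult_eq_bot_iff)
  also have "neg b \<boxplus> r = c"
    using plus_neg_mult_le[of "neg b" c] assms by (simp add: r_def plus_eq_one_iff m_comm)
  finally have le: "a \<boxplus> r \<preceq> c" .
  have "a \<boxplus> b = neg c \<boxplus> (a \<boxplus> r)"
    using assms r by (simp add: plus_lcomm flip: b)
  then have "(a \<boxplus> b) \<otimes> c = c \<otimes> (neg c \<boxplus> (a \<boxplus> r))"
    using assms r by (simp add: m_comm)
  also have "\<dots> = a \<boxplus> r"
    using assms r le by (simp add: mult_neg_plus_le)
  finally show ?thesis
    using assms by (simp add: r_def m_comm)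
qed

text \<open>Over the reals, neither inner sum exceeds 1 but the total reaches it, and both sides are
  \<open>a + b + c - 1\<close>. The element \<open>d\<close> is the gap \<open>1 - b - c\<close>. It
  lies below \<open>a\<close>, so \<open>a = d \<boxplus> y\<close>, and
  \<open>b \<boxplus> d = neg c\<close> puts \<open>a \<boxplus> b\<close> into a form where
  \<open>c\<close> cancels.\<close>

lemma plus_mult_assoc:
  assumes "a \<in> carrier A" "b \<in> carrier A" "c \<in> carrier A"
    and "a \<otimes> b = bot" "b \<otimes> c = bot" "a \<boxplus> b \<boxplus> c = \<one>"
  shows "(a \<boxplus> b) \<otimes> c = a \<otimes> (b \<boxplus> c)"
proof -
  define d where "d = neg b \<otimes> neg c"
  define y where "y = a \<otimes> (b \<boxplus> c)"
  have closed: "d \<in> carrier A" "y \<in> carrier A"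
    using assms by (simp_all add: d_def y_def)
  have nd: "neg d = b \<boxplus> c"
    using assms by (simp add: d_def neg_mult)
  have "d \<preceq> a"
    using assms neg_le_swap[of a "b \<boxplus> c"] by (simp add: plus_assoc plus_eq_one_iff d_def neg_plus)
  then have a: "d \<boxplus> y = a"
    using plus_neg_mult_le[of d a] assms closed by (simp add: nd y_def m_comm)
  have bd: "b \<boxplus> d = neg c"
    using plus_neg_mult_le[of b "neg c"] assms by (simp add: d_def mult_eq_bot_iff)
  have "y \<preceq> neg b \<otimes> (neg (neg b) \<boxplus> c)"
    using assms by (simp add: y_def mult_mono mult_eq_bot_iff)
  moreover have "neg b \<otimes> (neg (neg b) \<boxplus> c) \<preceq> c"
    using assms mult_neg_plus[of "neg b" c] by simp
  ultimately have le: "y \<preceq> c"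
    using assms closed by (meson le_trans m_closed neg_closed plus_closed)
  have "a \<boxplus> b = b \<boxplus> d \<boxplus> y"
    using assms closed plus_comm[of a b] by (simp add: plus_assoc a)
  then have "(a \<boxplus> b) \<otimes> c = c \<otimes> (neg c \<boxplus> y)"
    using assms closed by (simp add: bd m_comm)
  then show ?thesis
    using assms closed le by (simp add: mult_neg_plus_le y_def)
qed

text \<open>The preceding lemma for the negations of \<open>a\<close>, \<open>b\<close> and
  \<open>c\<close>, negated: the case in which both inner sums carry.\<close>

lemma mult_plus_assoc:
  assumes "a \<in> carrier A" "b \<in> carrier A" "c \<in> carrier A"
    and "a \<boxplus> b = \<one>" "b \<boxplus> c = \<one>" "a \<otimes> b \<otimes> c = bot"
  shows "(a \<otimes> b) \<boxplus> c = a \<boxplus> (b \<otimes> c)"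
proof -
  have "(neg a \<boxplus> neg b) \<otimes> neg c = neg a \<otimes> (neg b \<boxplus> neg c)"
    using assms by (intro plus_mult_assoc) (simp_all flip: neg_plus neg_mult)
  then have "neg (a \<otimes> b \<boxplus> c) = neg (a \<boxplus> (b \<otimes> c))"
    using assms by (simp add: neg_plus neg_mult)
  then show ?thesis
    using assms by (metis m_closed neg_neg plus_closed)
qed

end

section \<open>Separation by homomorphisms into chains\<close>

context mv_algebra
begin

lemma imp_join_right:
  assumes "x \<in> carrier A" "y \<in> carrier A"
  shows "imp A (join A x y) y = imp A x y"
proof (rule le_antisym)
  show "imp A (join A x y) y \<preceq> imp A x y"
    using assms by (simp add: imp_mono)
  have "imp A x y \<otimes> join A x y \<preceq> y"
    using assms by (simp add: residuation imp_imp)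
  then show "imp A x y \<preceq> imp A (join A x y) y"
    using assms residuation[of "join A x y" "imp A x y" y] by (simp add: m_comm)
qed (use assms in auto)

lemma mult_imp_cancel: "\<lbrakk>x \<in> carrier A; y \<in> carrier A; y \<preceq> x\<rbrakk> \<Longrightarrow> x \<otimes> imp A x y = y"
  by (simp add: imp_eq_plus mult_neg_plus_le)

lemma join_eq_one_iff:
  assumes "x \<in> carrier A" "y \<in> carrier A"
  shows "join A x y = \<one> \<longleftrightarrow> imp A x y = y"
proof -
  have "y \<preceq> imp A x y"
    using assms residuation[of x y y] by simp
  moreover have "join A x y = \<one> \<longleftrightarrow> imp A x y \<preceq> y"
    using assms by (simp add: imp_eq_one_iff flip: imp_imp)
  ultimately show ?thesis
    using assms le_antisym[of y "imp A x y"] by auto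
qed

text \<open>With \<open>j\<close> the join, both implications may start from \<open>j\<close>
  instead. Since \<open>j \<otimes> imp A j x = x\<close>, the implication from
  \<open>imp A j x\<close> to \<open>imp A j y\<close> collapses to \<open>imp A x y\<close>, which
  is \<open>imp A j y\<close> again; by \<open>join_eq_one_iff\<close> the join is then
  \<open>\<one>\<close>.\<close>

lemma prelinear:
  assumes "x \<in> carrier A" "y \<in> carrier A"
  shows "join A (imp A x y) (imp A y x) = \<one>"
proof -
  define j where "j = join A x y"
  have j: "j \<in> carrier A" "x \<preceq> j" using assms by (simp_all add: j_def)
  have a: "imp A j x = imp A y x" and b: "imp A j y = imp A x y"
    using assms imp_join_right[of x y] imp_join_right[of y x] by (simp_all add: j_def join_comm)
  have "imp A (imp A j x) (imp A j y) = imp A (j \<otimes> imp A j x) y"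
    using assms j by (simp add: imp_imp_eq m_comm)
  also have "\<dots> = imp A j y"
    using assms j by (simp add: mult_imp_cancel b)
  finally have "join A (imp A j x) (imp A j y) = \<one>"
    using assms j by (simp add: join_eq_one_iff)
  then show ?thesis
    using assms by (simp add: a b join_comm)
qed

text \<open>In the form \<open>imp A x y = y\<close> the hypothesis can be iterated: each further
  factor \<open>x\<close> in the premise leaves \<open>y\<close> unchanged.\<close>

lemma join_pow_eq_one:
  assumes "x \<in> carrier A" "y \<in> carrier A" "join A x y = \<one>"
  shows "join A (x [^] (n::nat)) y = \<one>"
  using assms by (induction n) (simp_all add: join_eq_one_iff flip: imp_imp_eq)

lemma le_impI:
  "\<lbrakk>x \<otimes> t \<preceq> y; x \<in> carrier A; y \<in> carrier A; t \<in> carrier A\<rbrakk> \<Longrightarrow> t \<preceq> imp A x y"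
  by (simp add: residuation)

lemma imp_meet_right: "\<lbrakk>x \<in> carrier A; y \<in> carrier A\<rbrakk> \<Longrightarrow> imp A x (meet A x y) = imp A x y"
  by (rule le_antisym) (simp_all add: imp_mono le_impI le_meetI mult_imp_le)

text \<open>Closure under the product, not merely under meets, makes membership of implications
  transitive, so that the filter induces a congruence.\<close>

definition mv_filter where
  "mv_filter F \<longleftrightarrow> F \<subseteq> carrier A \<and> \<one> \<in> F \<and> (\<forall>x\<in>F. \<forall>y\<in>F. x \<otimes> y \<in> F) \<and>
     (\<forall>x\<in>F. \<forall>y\<in>carrier A. x \<preceq> y \<longrightarrow> y \<in> F)"

lemma
  assumes "mv_filter F"
  shows mv_filter_subset: "F \<subseteq> carrier A"
    and mv_filter_one: "\<one> \<in> F"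
    and mv_filter_mult: "\<lbrakk>x \<in> F; y \<in> F\<rbrakk> \<Longrightarrow> x \<otimes> y \<in> F"
    and mv_filter_up: "\<lbrakk>x \<in> F; x \<preceq> y; y \<in> carrier A\<rbrakk> \<Longrightarrow> y \<in> F"
  using assms by (auto simp: mv_filter_def)

lemma mv_filter_adjoin:
  assumes F: "mv_filter F" and p: "p \<in> carrier A"
  shows "mv_filter {z \<in> carrier A. \<exists>f\<in>F. \<exists>n::nat. f \<otimes> p [^] n \<preceq> z}" (is "mv_filter ?G")
proof -
  have FA: "F \<subseteq> carrier A" using F by (simp add: mv_filter_def)
  have "x \<otimes> y \<in> ?G" if "x \<in> ?G" "y \<in> ?G" for x y
  proof -
    from that obtain f m g n where *: "x \<in> carrier A" "f \<in> F" "f \<otimes> p [^] (m::nat) \<preceq> x"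
      "y \<in> carrier A" "g \<in> F" "g \<otimes> p [^] (n::nat) \<preceq> y" by blast
    then have fg: "f \<in> carrier A" "g \<in> carrier A" using FA by auto
    have "(f \<otimes> p [^] m) \<otimes> (g \<otimes> p [^] n) \<preceq> x \<otimes> y"
      using * fg p by (simp add: mult_mono)
    moreover have "(f \<otimes> p [^] m) \<otimes> (g \<otimes> p [^] n) = (f \<otimes> g) \<otimes> p [^] (m + n)"
      using fg p by (simp add: m_assoc m_lcomm flip: nat_pow_mult)
    moreover have "f \<otimes> g \<in> F" using F * by (simp add: mv_filter_def)
    ultimately show ?thesis using * by auto
  qed
  moreover have "\<one> \<in> ?G"
    using F p by (auto simp: mv_filter_def intro!: bexI[of _ \<one>])
  moreover have "y \<in> ?G" if "x \<in> ?G" "y \<in> carrier A" "x \<preceq> y" for x y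
  proof -
    from that obtain f n where *: "x \<in> carrier A" "f \<in> F" "f \<otimes> p [^] (n::nat) \<preceq> x" by blast
    then have "f \<otimes> p [^] n \<preceq> y"
      using FA p that le_trans[of "f \<otimes> p [^] n" x y] by auto
    then show ?thesis
      using * that by blast
  qed
  ultimately show ?thesis
    unfolding mv_filter_def by (intro conjI ballI impI) blast+
qed

text \<open>Take a filter maximal among those without \<open>d\<close>. If it contained neither
  implication, adjoining either one would produce \<open>d\<close>, so \<open>d\<close> would lie
  above \<open>f \<otimes> P\<close> and \<open>g \<otimes> Q\<close> with \<open>P\<close> and
  \<open>Q\<close> powers of the two implications. Both powers are then below
  \<open>imp A (f \<otimes> g) d\<close>; by prelinearity their join is \<open>\<one>\<close>, which
  forces \<open>f \<otimes> g \<preceq> d\<close> and puts \<open>d\<close> into the filter.\<close>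

lemma prime_filter_exists:
  assumes d: "d \<in> carrier A" "d \<noteq> \<one>"
  obtains F where "mv_filter F" "d \<notin> F"
    "\<And>x y. \<lbrakk>x \<in> carrier A; y \<in> carrier A\<rbrakk> \<Longrightarrow> imp A x y \<in> F \<or> imp A y x \<in> F"
proof -
  let ?X = "{F. mv_filter F \<and> d \<notin> F}"
  have "{\<one>} \<in> ?X"
    using d by (auto simp: mv_filter_def one_le_iff)
  moreover have "\<Union>C \<in> ?X" if "C \<noteq> {}" "subset.chain ?X C" for C
  proof -
    have C: "\<And>F. F \<in> C \<Longrightarrow> mv_filter F \<and> d \<notin> F"
      using that by (auto simp: subset.chain_def)
    have "x \<otimes> y \<in> \<Union>C" if xy: "x \<in> \<Union>C" "y \<in> \<Union>C" for x y
    proof -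
      from xy obtain F G where FG: "F \<in> C" "G \<in> C" "x \<in> F" "y \<in> G" by blast
      then have "F \<subseteq> G \<or> G \<subseteq> F"
        using \<open>subset.chain ?X C\<close> by (auto simp: subset.chain_def)
      then show ?thesis
        using FG C mv_filter_mult[of F x y] mv_filter_mult[of G x y] by blast
    qed
    moreover have "\<Union>C \<subseteq> carrier A"
      using C mv_filter_subset by blast
    moreover have "\<one> \<in> \<Union>C"
      using C \<open>C \<noteq> {}\<close> mv_filter_one by blast
    moreover have "y \<in> \<Union>C" if "x \<in> \<Union>C" "x \<preceq> y" "y \<in> carrier A" for x y
      using that C mv_filter_up by blast
    ultimately have "mv_filter (\<Union>C)"
      by (simp add: mv_filter_def)
    then show ?thesis
      using C by blast
  qed
  ultimately have "\<exists>M\<in>?X. \<forall>X\<in>?X. M \<subseteq> X \<longrightarrow> X = M"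
    by (intro subset_Zorn_nonempty) auto
  then obtain F where F: "mv_filter F" "d \<notin> F"
    and max: "\<And>G. \<lbrakk>mv_filter G; d \<notin> G; F \<subseteq> G\<rbrakk> \<Longrightarrow> G = F"
    by auto
  have FA: "F \<subseteq> carrier A" using F by (simp add: mv_filter_def)
  have adjoin: "\<exists>f\<in>F. \<exists>n::nat. f \<otimes> p [^] n \<preceq> d" if p: "p \<in> carrier A" "p \<notin> F" for p
  proof -
    let ?G = "{z \<in> carrier A. \<exists>f\<in>F. \<exists>n::nat. f \<otimes> p [^] n \<preceq> z}"
    have "f \<in> ?G" if "f \<in> F" for f
      using that FA p by (auto intro!: bexI[of _ f] exI[of _ "0::nat"])
    moreover have "p \<in> ?G"
      using F p by (auto simp: mv_filter_def intro!: bexI[of _ \<one>] exI[of _ "1::nat"])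
    ultimately have "?G \<noteq> F" "F \<subseteq> ?G"
      using p by auto
    then have "d \<in> ?G"
      using max[OF mv_filter_adjoin[OF F(1) p(1)]] by (metis (no_types, lifting))
    then show ?thesis by simp
  qed
  have "imp A x y \<in> F \<or> imp A y x \<in> F" if xy: "x \<in> carrier A" "y \<in> carrier A" for x y
  proof (rule ccontr)
    assume "\<not> ?thesis"
    then have *: "imp A x y \<notin> F" "imp A y x \<notin> F" by simp_all
    from adjoin[OF imp_closed[OF xy] *(1)] obtain f m
      where f: "f \<in> F" and fd: "f \<otimes> imp A x y [^] (m::nat) \<preceq> d" by blast
    from adjoin[OF imp_closed[OF xy(2,1)] *(2)] obtain g n
      where g: "g \<in> F" and gd: "g \<otimes> imp A y x [^] (n::nat) \<preceq> d" by blast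
    note fg = f g
    define P Q where "P = imp A x y [^] m" and "Q = imp A y x [^] n"
    have cl: "f \<in> carrier A" "g \<in> carrier A" "P \<in> carrier A" "Q \<in> carrier A"
      using fg FA xy by (auto simp: P_def Q_def)
    have "join A P (imp A y x) = \<one>"
      using join_pow_eq_one[OF _ _ prelinear[OF xy]] xy by (simp add: P_def)
    then have PQ: "join A P Q = \<one>"
      using join_pow_eq_one[of "imp A y x" P n] xy cl by (simp add: Q_def join_comm)
    have "(f \<otimes> g) \<otimes> P \<preceq> f \<otimes> P" "(f \<otimes> g) \<otimes> Q \<preceq> g \<otimes> Q"
      using cl by (simp_all add: mult_mono)
    then have "(f \<otimes> g) \<otimes> P \<preceq> d" "(f \<otimes> g) \<otimes> Q \<preceq> d"
      using fd gd cl d le_trans[of "(f \<otimes> g) \<otimes> P" "f \<otimes> P" d]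
        le_trans[of "(f \<otimes> g) \<otimes> Q" "g \<otimes> Q" d]
      unfolding P_def[symmetric] Q_def[symmetric] by simp_all
    then have "join A P Q \<preceq> imp A (f \<otimes> g) d"
      using cl d by (simp add: join_leI residuation)
    then have "f \<otimes> g \<preceq> d"
      using cl d by (simp add: PQ one_le_iff imp_eq_one_iff)
    then have "d \<in> F"
      using mv_filter_up[OF F(1)] mv_filter_mult[OF F(1)] fg d by blast
    then show False using F by simp
  qed
  then show thesis
    using that F by blast
qed

end

section \<open>The quotient by a filter\<close>

locale mv_algebra_filter = mv_algebra +
  fixes F
  assumes filt: "mv_filter F"
begin

lemmas one_in_filter = mv_filter_one[OF filt]
  and filter_mult = mv_filter_mult[OF filt]
  and filter_mp = mv_filter_up[OF filt]

definition eqv where "eqv x y \<longleftrightarrow> imp A x y \<in> F \<and> imp A y x \<in> F"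

lemma eqv_refl: "x \<in> carrier A \<Longrightarrow> eqv x x"
  using imp_eq_one_iff[of x x] by (simp add: eqv_def one_in_filter)

lemma eqv_sym: "eqv x y \<Longrightarrow> eqv y x"
  by (auto simp: eqv_def)

lemma imp_filter_trans:
  assumes "imp A x y \<in> F" "imp A y z \<in> F" "x \<in> carrier A" "y \<in> carrier A" "z \<in> carrier A"
  shows "imp A x z \<in> F"
proof (rule filter_mp)
  show "imp A x y \<otimes> imp A y z \<in> F"
    using assms by (simp add: filter_mult)
  have "(x \<otimes> imp A x y) \<otimes> imp A y z \<preceq> y \<otimes> imp A y z"
    using assms by (simp add: mult_mono mult_imp_le)
  then have "(x \<otimes> imp A x y) \<otimes> imp A y z \<preceq> z"
    using assms mult_imp_le[of y z]
      le_trans[of "(x \<otimes> imp A x y) \<otimes> imp A y z" "y \<otimes> imp A y z" z] by simp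
  then show "imp A x y \<otimes> imp A y z \<preceq> imp A x z"
    using assms by (intro le_impI) (simp_all add: m_assoc)
qed (use assms in auto)

lemma eqv_trans:
  "\<lbrakk>eqv x y; eqv y z; x \<in> carrier A; y \<in> carrier A; z \<in> carrier A\<rbrakk> \<Longrightarrow> eqv x z"
  unfolding eqv_def using imp_filter_trans[of x y z] imp_filter_trans[of z y x] by simp

text \<open>This and the next four lemmas bound the change of an operation in one argument from
  below by the implication between the old and the new argument. As filters are upward closed,
  \<open>eqv\<close> is therefore a congruence.\<close>

lemma imp_mult_left:
  assumes "x \<in> carrier A" "x' \<in> carrier A" "y \<in> carrier A"
  shows "imp A x x' \<preceq> imp A (x \<otimes> y) (x' \<otimes> y)"
proof (rule le_impI)
  have "(x \<otimes> imp A x x') \<otimes> y \<preceq> x' \<otimes> y"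
    using assms by (simp add: mult_mono mult_imp_le)
  then show "x \<otimes> y \<otimes> imp A x x' \<preceq> x' \<otimes> y"
    using assms by (simp add: m_assoc m_comm[of y])
qed (use assms in auto)

lemma imp_meet_left:
  assumes "x \<in> carrier A" "x' \<in> carrier A" "y \<in> carrier A"
  shows "imp A x x' \<preceq> imp A (meet A x y) (meet A x' y)"
proof (intro le_impI le_meetI)
  have "meet A x y \<otimes> imp A x x' \<preceq> x \<otimes> imp A x x'"
    using assms by (simp add: mult_mono)
  then show "meet A x y \<otimes> imp A x x' \<preceq> x'"
    using assms mult_imp_le[of x x']
      le_trans[of "meet A x y \<otimes> imp A x x'" "x \<otimes> imp A x x'" x'] by simp
  have "meet A x y \<otimes> imp A x x' \<preceq> y \<otimes> \<one>"
    using assms by (intro mult_mono) simp_all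
  then show "meet A x y \<otimes> imp A x x' \<preceq> y"
    using assms by simp
qed (use assms in auto)

lemma imp_join_left:
  assumes "x \<in> carrier A" "x' \<in> carrier A" "y \<in> carrier A"
  shows "imp A x x' \<preceq> imp A (join A x y) (join A x' y)"
proof (rule le_impI)
  let ?t = "imp A x x'"
  have "?t \<otimes> x \<preceq> join A x' y"
    using assms mult_imp_le[of x x'] le_trans[of "x \<otimes> ?t" x' "join A x' y"]
    by (simp add: m_comm[of _ x])
  moreover have "?t \<otimes> y \<preceq> join A x' y"
    using assms le_trans[of "?t \<otimes> y" y "join A x' y"] by simp
  ultimately have "join A x y \<preceq> imp A ?t (join A x' y)"
    using assms by (simp add: join_leI le_impI)
  then show "join A x y \<otimes> ?t \<preceq> join A x' y"
    using assms by (simp add: m_comm[of _ ?t] residuation)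
qed (use assms in auto)

lemma imp_imp_left:
  assumes "x \<in> carrier A" "x' \<in> carrier A" "y \<in> carrier A"
  shows "imp A x' x \<preceq> imp A (imp A x y) (imp A x' y)"
proof (intro le_impI)
  have "imp A x y \<otimes> (x' \<otimes> imp A x' x) \<preceq> imp A x y \<otimes> x"
    using assms by (simp add: mult_mono mult_imp_le)
  moreover have "imp A x y \<otimes> x \<preceq> y"
    using assms mult_imp_le[of x y] m_comm[of x "imp A x y"] by simp
  ultimately have "imp A x y \<otimes> (x' \<otimes> imp A x' x) \<preceq> y"
    using assms le_trans[of "imp A x y \<otimes> (x' \<otimes> imp A x' x)" "imp A x y \<otimes> x" y] by simp
  then show "x' \<otimes> (imp A x y \<otimes> imp A x' x) \<preceq> y"
    using assms by (simp add: m_lcomm)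
qed (use assms in auto)

lemma imp_imp_right:
  assumes "x \<in> carrier A" "y \<in> carrier A" "y' \<in> carrier A"
  shows "imp A y y' \<preceq> imp A (imp A x y) (imp A x y')"
proof (intro le_impI)
  have "(x \<otimes> imp A x y) \<otimes> imp A y y' \<preceq> y \<otimes> imp A y y'"
    using assms by (simp add: mult_mono mult_imp_le)
  then show "x \<otimes> (imp A x y \<otimes> imp A y y') \<preceq> y'"
    using assms mult_imp_le[of y y'] m_assoc[of x "imp A x y" "imp A y y'"]
      le_trans[of "(x \<otimes> imp A x y) \<otimes> imp A y y'" "y \<otimes> imp A y y'" y'] by simp
qed (use assms in auto)

lemma eqv_cong_left:
  assumes "eqv x x'" "x \<in> carrier A" "x' \<in> carrier A" "y \<in> carrier A"
  shows "eqv (x \<otimes> y) (x' \<otimes> y)" "eqv (meet A x y) (meet A x' y)"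
    "eqv (join A x y) (join A x' y)" "eqv (imp A x y) (imp A x' y)"
  using assms unfolding eqv_def
  by (simp_all add: filter_mp[OF _ imp_mult_left] filter_mp[OF _ imp_meet_left]
      filter_mp[OF _ imp_join_left] filter_mp[OF _ imp_imp_left])

lemma eqv_cong_right:
  assumes "eqv y y'" "x \<in> carrier A" "y \<in> carrier A" "y' \<in> carrier A"
  shows "eqv (x \<otimes> y) (x \<otimes> y')" "eqv (meet A x y) (meet A x y')"
    "eqv (join A x y) (join A x y')" "eqv (imp A x y) (imp A x y')"
  using eqv_cong_left(1-3)[of y y' x] assms
  by (simp_all add: m_comm meet_comm join_comm eqv_def filter_mp[OF _ imp_imp_right])

text \<open>One chosen representative per class keeps the carrier of the quotient inside the type of
  \<open>A\<close>.\<close>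

definition rep where "rep x = (SOME y. y \<in> carrier A \<and> eqv x y)"

lemma
  assumes "x \<in> carrier A"
  shows rep_closed [simp]: "rep x \<in> carrier A" and eqv_rep: "eqv x (rep x)"
proof -
  have "rep x \<in> carrier A \<and> eqv x (rep x)"
    unfolding rep_def by (rule someI[of _ x]) (use assms in \<open>simp add: eqv_refl\<close>)
  then show "rep x \<in> carrier A" "eqv x (rep x)" by auto
qed

lemma rep_eq_iff:
  assumes "x \<in> carrier A" "y \<in> carrier A"
  shows "rep x = rep y \<longleftrightarrow> eqv x y"
proof
  assume "rep x = rep y"
  then show "eqv x y"
    using assms eqv_rep[of x] eqv_sym[OF eqv_rep[of y]] eqv_trans[of x "rep x" y] by simp
next
  assume "eqv x y"
  then have "z \<in> carrier A \<and> eqv x z \<longleftrightarrow> z \<in> carrier A \<and> eqv y z" for z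
    using assms eqv_trans[of x y z] eqv_trans[of y x z] eqv_sym[of x y] by blast
  then show "rep x = rep y" by (simp add: rep_def)
qed

text \<open>Dropping inner occurrences of \<open>rep\<close> reduces the equational axioms of the
  quotient to those of \<open>A\<close>.\<close>

lemma rep_simps [simp]:
  assumes "x \<in> carrier A" "y \<in> carrier A"
  shows "rep (rep x \<otimes> y) = rep (x \<otimes> y)" "rep (x \<otimes> rep y) = rep (x \<otimes> y)"
    "rep (meet A (rep x) y) = rep (meet A x y)" "rep (meet A x (rep y)) = rep (meet A x y)"
    "rep (join A (rep x) y) = rep (join A x y)" "rep (join A x (rep y)) = rep (join A x y)"
    "rep (imp A (rep x) y) = rep (imp A x y)" "rep (imp A x (rep y)) = rep (imp A x y)"
  using assms eqv_rep[of x] eqv_rep[of y]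
  by (simp_all add: rep_eq_iff eqv_sym eqv_cong_left eqv_cong_right)

definition quot :: "'a l0_algebra" where
  "quot = \<lparr>carrier = rep ` carrier A, monoid.mult = (\<lambda>x y. rep (x \<otimes> y)), one = rep \<one>,
     meet = (\<lambda>x y. rep (meet A x y)), join = (\<lambda>x y. rep (join A x y)),
     imp = (\<lambda>x y. rep (imp A x y))\<rparr>"

lemma quot_le_iff:
  assumes "x \<in> carrier A" "y \<in> carrier A"
  shows "l0_le quot (rep x) (rep y) \<longleftrightarrow> imp A x y \<in> F"
proof -
  have "l0_le quot (rep x) (rep y) \<longleftrightarrow> eqv (meet A x y) x"
    using assms by (simp add: l0_le_def quot_def rep_eq_iff)
  moreover have "imp A (meet A x y) x \<in> F"
    using assms imp_eq_one_iff[of "meet A x y" x] by (simp add: one_in_filter)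
  ultimately show ?thesis
    using assms by (simp add: eqv_def imp_meet_right)
qed

lemma mv_algebra_quot: "mv_algebra quot"
proof -
  have [simp]: "carrier quot = rep ` carrier A" "\<one>\<^bsub>quot\<^esub> = rep \<one>"
    "x \<otimes>\<^bsub>quot\<^esub> y = rep (x \<otimes> y)" "meet quot x y = rep (meet A x y)"
    "join quot x y = rep (join A x y)" "imp quot x y = rep (imp A x y)" for x y
    by (simp_all add: quot_def)
  have [simp]: "rep (rep x) = rep x" if "x \<in> carrier A" for x
    using that eqv_sym[OF eqv_rep[of x]] by (simp add: rep_eq_iff)
  show ?thesis
  proof (unfold_locales, goal_cases)
    case (2 x y z)
    then have "x \<in> carrier A" "y \<in> carrier A" "z \<in> carrier A" by auto
    then show ?case by (simp add: m_assoc)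
  next
    case (12 x y z)
    then have "x \<in> carrier A" "y \<in> carrier A" "z \<in> carrier A" by auto
    then show ?case by (simp add: meet_assoc)
  next
    case (13 x y z)
    then have "x \<in> carrier A" "y \<in> carrier A" "z \<in> carrier A" by auto
    then show ?case by (simp add: join_assoc)
  next
    case (16 x y z)
    then show ?case
      by (auto simp: quot_le_iff imp_imp_eq m_comm)
  next
    case (17 x)
    then show ?case
      using imp_eq_one_iff[of _ \<one>] by (auto simp: quot_le_iff one_in_filter)
  next
    case 18
    show ?case
      using imp_eq_one_iff[of bot] by (auto simp: quot_le_iff one_in_filter intro!: bexI[of _ bot])
  qed (auto simp: m_comm meet_comm join_comm meet_absorb join_absorb imp_imp)
qed

lemma rep_hom: "rep \<in> l0_hom A quot"
  by (auto simp: l0_hom_def quot_def)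

end

locale mv_chain = mv_algebra +
  assumes le_total: "\<lbrakk>x \<in> carrier A; y \<in> carrier A\<rbrakk> \<Longrightarrow> x \<preceq> y \<or> y \<preceq> x"

text \<open>The part of Chang's subdirect representation theorem that completeness needs.\<close>

lemma (in mv_algebra) mv_chain_separation:
  assumes "x \<in> carrier A" "y \<in> carrier A" "\<not> x \<preceq> y"
  obtains B :: "'a l0_algebra" and h
    where "mv_chain B" "h \<in> l0_hom A B" "\<not> l0_le B (h x) (h y)"
proof -
  obtain F where F: "mv_filter F" "imp A x y \<notin> F"
    "\<And>x y. \<lbrakk>x \<in> carrier A; y \<in> carrier A\<rbrakk> \<Longrightarrow> imp A x y \<in> F \<or> imp A y x \<in> F"
    using prime_filter_exists[of "imp A x y"] assms by (auto simp: imp_eq_one_iff)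
  interpret mv_algebra_filter A F
    by unfold_locales (rule F)
  interpret quot: mv_algebra quot
    by (rule mv_algebra_quot)
  have "mv_chain quot"
  proof unfold_locales
    fix u v
    assume "u \<in> carrier quot" "v \<in> carrier quot"
    then obtain a b where "u = rep a" "v = rep b" "a \<in> carrier A" "b \<in> carrier A"
      by (auto simp: quot_def)
    then show "l0_le quot u v \<or> l0_le quot v u"
      using F(3)[of a b] by (simp add: quot_le_iff)
  qed
  then show thesis
    using that rep_hom F(2) assms quot_le_iff by blast
qed

section \<open>Real solutions of systems solvable in an ordered group\<close>

text \<open>The flags mark strict bounds. If the largest lower and the least upper bound differ,
  their midpoint works. If they coincide, their common value works: a strict bound equal to it would
  violate \<open>sep\<close> against the opposite extreme.\<close>

lemma real_between_finite_bounds: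
  fixes L U :: "(real \<times> bool) set"
  assumes "finite L" "finite U"
    and sep: "\<And>l a u b. \<lbrakk>(l, a) \<in> L; (u, b) \<in> U\<rbrakk> \<Longrightarrow> if a \<or> b then l < u else l \<le> u"
  obtains t where "\<And>l a. (l, a) \<in> L \<Longrightarrow> if a then l < t else l \<le> t"
    "\<And>u b. (u, b) \<in> U \<Longrightarrow> if b then t < u else t \<le> u"
proof (cases "L = {} \<or> U = {}")
  case True
  then show ?thesis
  proof
    assume "L = {}"
    have "Min (insert 0 (fst ` U)) - 1 < u" if "(u, b) \<in> U" for u b
    proof -
      have "Min (insert 0 (fst ` U)) \<le> u"
        using that assms(2) by (intro Min_le) force+
      then show ?thesis by simp
    qed
    then show ?thesis
      using that[of "Min (insert 0 (fst ` U)) - 1"] \<open>L = {}\<close> by (auto simp: less_imp_le)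
  next
    assume "U = {}"
    have "l < Max (insert 0 (fst ` L)) + 1" if "(l, a) \<in> L" for l a
    proof -
      have "l \<le> Max (insert 0 (fst ` L))"
        using that assms(1) by (intro Max_ge) force+
      then show ?thesis by simp
    qed
    then show ?thesis
      using that[of "Max (insert 0 (fst ` L)) + 1"] \<open>U = {}\<close> by (auto simp: less_imp_le)
  qed
next
  case False
  define l u where "l = Max (fst ` L)" and "u = Min (fst ` U)"
  have le: "x \<le> l" if "(x, a) \<in> L" for x a
    using that assms unfolding l_def by (force intro: Max_ge)
  have ue: "u \<le> y" if "(y, b) \<in> U" for y b
    using that assms unfolding u_def by (force intro: Min_le)
  have "l \<in> fst ` L" "u \<in> fst ` U"
    using False assms by (auto simp: l_def u_def)
  then obtain a b where l: "(l, a) \<in> L" and u: "(u, b) \<in> U" by force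
  have "l \<le> u" using sep[OF l u] by (auto split: if_splits)
  show ?thesis
  proof (cases "l < u")
    case True
    show ?thesis
    proof (rule that[of "(l + u) / 2"])
      show "if a then x < (l + u) / 2 else x \<le> (l + u) / 2" if "(x, a) \<in> L" for x a
        using le[OF that] True by auto
      show "if b then (l + u) / 2 < y else (l + u) / 2 \<le> y" if "(y, b) \<in> U" for y b
        using ue[OF that] True by auto
    qed
  next
    case False
    then have "u = l" using \<open>l \<le> u\<close> by simp
    show ?thesis
    proof (rule that[of l])
      show "if a then x < l else x \<le> l" if "(x, a) \<in> L" for x a
        using sep[OF that u] le[OF that] \<open>u = l\<close> by (auto split: if_splits)
      show "if b then l < y else l \<le> y" if "(y, b) \<in> U" for y b
        using sep[OF l that] ue[OF that] \<open>u = l\<close> by (auto split: if_splits)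
    qed
  qed
qed

section \<open>Integer linear systems over an ordered group\<close>

context comm_group
begin

text \<open>The elements of \<open>S\<close> double as names of the unknowns, so one coefficient
  vector \<open>v\<close> describes both a real linear form and its value in the group.\<close>

definition lincomb :: "'a set \<Rightarrow> ('a \<Rightarrow> int) \<Rightarrow> 'a" where
  "lincomb S v = (\<Otimes>x\<in>S. x [^] v x)"

lemma lincomb_closed [simp]: "S \<subseteq> carrier G \<Longrightarrow> lincomb S v \<in> carrier G"
  unfolding lincomb_def by (rule finprod_closed) auto

lemma lincomb_add:
  assumes "S \<subseteq> carrier G"
  shows "lincomb S (\<lambda>x. v x + u x) = lincomb S v \<otimes> lincomb S u"
proof -
  have "lincomb S (\<lambda>x. v x + u x) = (\<Otimes>x\<in>S. x [^] v x \<otimes> x [^] u x)"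
    unfolding lincomb_def using assms by (intro finprod_cong') (auto simp: int_pow_mult)
  also have "\<dots> = lincomb S v \<otimes> lincomb S u"
    unfolding lincomb_def using assms by (intro finprod_multf) auto
  finally show ?thesis .
qed

lemma lincomb_zero: "lincomb S (\<lambda>x. 0) = \<one>"
  by (simp add: lincomb_def)

lemma lincomb_scale:
  "S \<subseteq> carrier G \<Longrightarrow> lincomb S (\<lambda>x. int n * v x) = lincomb S v [^] n"
proof (induction n)
  case (Suc n)
  then show ?case
    using lincomb_add[of S "\<lambda>x. int n * v x" v] by (simp add: algebra_simps)
qed (simp add: lincomb_zero)

lemma lincomb_delta:
  assumes "finite S" "S \<subseteq> carrier G" "z \<in> S"
  shows "lincomb S (\<lambda>x. if x = z then 1 else 0) = z"
proof -
  have "lincomb S (\<lambda>x. if x = z then 1 else 0) = (\<Otimes>x\<in>S. if z = x then x else \<one>)"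
    unfolding lincomb_def using assms by (intro finprod_cong') (auto simp: int_pow_1)
  also have "\<dots> = z"
    using assms finprod_singleton[of z S "\<lambda>x. x"] by auto
  finally show ?thesis .
qed

lemma lincomb_insert_zero:
  assumes "finite S" "insert k S \<subseteq> carrier G" "k \<notin> S" "v k = 0"
  shows "lincomb (insert k S) v = lincomb S v"
proof -
  have "lincomb (insert k S) v = k [^] v k \<otimes> lincomb S v"
    unfolding lincomb_def using assms by (intro finprod_insert) auto
  then show ?thesis using assms by simp
qed

end

text \<open>\<open>P\<close> is a strict positive cone: \<open>x < y\<close> is expressed by
  \<open>r \<otimes> x = y\<close> with \<open>r \<in> P\<close>, so no order relation has to be
  carried along.\<close>

locale cone_group = comm_group +
  fixes P
  assumes P_subset: "P \<subseteq> carrier G"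
    and P_mult: "\<lbrakk>x \<in> P; y \<in> P\<rbrakk> \<Longrightarrow> x \<otimes> y \<in> P"
    and one_notin_P: "\<one> \<notin> P"
begin

definition sign_set where "sign_set b = (if b then P else insert \<one> P)"

lemma sign_set_subset: "sign_set b \<subseteq> carrier G"
  using P_subset by (simp add: sign_set_def)

lemma sign_set_mult: "\<lbrakk>x \<in> sign_set a; y \<in> sign_set b\<rbrakk> \<Longrightarrow> x \<otimes> y \<in> sign_set (a \<or> b)"
  using P_subset P_mult by (auto simp: sign_set_def split: if_splits)

lemma sign_set_pow: "x \<in> sign_set b \<Longrightarrow> x [^] Suc n \<in> sign_set b"
proof (induction n)
  case 0
  then show ?case using sign_set_subset[of b] by auto
next
  case (Suc n)
  then show ?case using sign_set_mult[of "x [^] Suc n" b x b] by simp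
qed

lemma lincomb_scale_sign_set:
  assumes "S \<subseteq> carrier G" "lincomb S v \<in> sign_set b" "0 < c"
  shows "lincomb S (\<lambda>x. c * v x) \<in> sign_set b"
proof -
  obtain n where "c = int (Suc n)"
    using assms(3) by (metis zero_less_imp_eq_int gr0_conv_Suc)
  then show ?thesis
    using lincomb_scale[of S "Suc n" v] sign_set_pow[of "lincomb S v" b n] assms by simp
qed

text \<open>Fourier-Motzkin elimination: each pair of a lower and an upper bound on the eliminated
  variable is combined into a constraint that again holds in the group.\<close>

lemma fourier_motzkin:
  assumes "finite S" "S \<subseteq> carrier G" "finite T"
    and "\<And>v b. (v, b) \<in> T \<Longrightarrow> lincomb S v \<in> sign_set b"
  shows "\<exists>w :: 'a \<Rightarrow> real. \<forall>v b. (v, b) \<in> T \<longrightarrow>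
    (if b then 0 < (\<Sum>x\<in>S. of_int (v x) * w x) else 0 \<le> (\<Sum>x\<in>S. of_int (v x) * w x))"
  using assms
proof (induction S arbitrary: T rule: finite_induct)
  case empty
  \<comment> \<open>Without unknowns every form has the value \<open>\<one>\<close>, which is
    outside \<open>P\<close>, so no constraint is strict.\<close>
  then have "b = False" if "(v, b) \<in> T" for v b
    using that one_notin_P by (fastforce simp: lincomb_def sign_set_def split: if_splits)
  then show ?case by auto
next
  case (insert k S)
  \<comment> \<open>For \<open>p\<close> in \<open>Tp\<close> and \<open>q\<close> in
    \<open>Tn\<close> both multipliers, \<open>- q k\<close> and \<open>p k\<close>, are positive,
    and the coefficient at \<open>k\<close> cancels.\<close>
  define comb where "comb = (\<lambda>(p, a) (q, b). ((\<lambda>x. - q k * p x + p k * q x) :: 'a \<Rightarrow> int, a \<or> b))"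
  define T0 where "T0 = {(v, b) \<in> T. v k = 0}"
  define Tp where "Tp = {(v, b) \<in> T. 0 < v k}"
  define Tn where "Tn = {(v, b) \<in> T. v k < 0}"
  have fin: "finite T0" "finite Tp" "finite Tn"
    using \<open>finite T\<close> by (auto simp: T0_def Tp_def Tn_def intro: finite_subset[of _ T])
  define T' where "T' = T0 \<union> (\<lambda>(c, d). comb c d) ` (Tp \<times> Tn)"
  have "lincomb S v \<in> sign_set b" if vb: "(v, b) \<in> T'" for v b
  proof -
    have "v k = 0 \<and> lincomb (insert k S) v \<in> sign_set b"
    proof (cases "(v, b) \<in> T0")
      case True
      then show ?thesis
        using insert.prems by (auto simp: T0_def)
    next
      case False
      then obtain p a q c where pq: "(p, a) \<in> Tp" "(q, c) \<in> Tn" "(v, b) = comb (p, a) (q, c)"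
        using vb by (force simp: T'_def)
      then have v: "v = (\<lambda>x. - q k * p x + p k * q x)" "b = (a \<or> c)"
        by (auto simp: comb_def)
      have "lincomb (insert k S) (\<lambda>x. - q k * p x) \<in> sign_set a"
        "lincomb (insert k S) (\<lambda>x. p k * q x) \<in> sign_set c"
        using pq insert.prems by (auto intro!: lincomb_scale_sign_set simp: Tp_def Tn_def
            simp del: mult_minus_left)
      then show ?thesis
        using insert.prems(1) sign_set_mult unfolding v by (subst lincomb_add) auto
    qed
    then show ?thesis
      using insert.hyps insert.prems(1) lincomb_insert_zero[of S k v] by auto
  qed
  moreover have "finite T'"
    using fin by (simp add: T'_def)
  ultimately obtain w :: "'a \<Rightarrow> real" where w: "\<And>v b. (v, b) \<in> T' \<Longrightarrow>
    (if b then 0 < (\<Sum>x\<in>S. of_int (v x) * w x) else 0 \<le> (\<Sum>x\<in>S. of_int (v x) * w x))"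
    using insert.IH[of T'] insert.prems(1) by auto
  define s where "s = (\<lambda>v :: 'a \<Rightarrow> int. \<Sum>x\<in>S. of_int (v x) * w x)"
  \<comment> \<open>The value of the unknown \<open>k\<close> that makes the constraint an equality:
    a lower bound when the coefficient of \<open>k\<close> is positive, an upper bound when it is
    negative.\<close>
  define bnd where "bnd = (\<lambda>v. - s v / of_int (v k))"
  have sep: "if a \<or> b then bnd p < bnd q else bnd p \<le> bnd q"
    if "(p, a) \<in> Tp" "(q, b) \<in> Tn" for p a q b
  proof -
    have "comb (p, a) (q, b) \<in> T'"
      using that by (force simp: T'_def)
    then have "((\<lambda>x. - q k * p x + p k * q x), a \<or> b) \<in> T'"
      by (simp add: comb_def)
    then have "if a \<or> b then 0 < s (\<lambda>x. - q k * p x + p k * q x)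
        else 0 \<le> s (\<lambda>x. - q k * p x + p k * q x)"
      unfolding s_def by (rule w)
    moreover have "s (\<lambda>x. - q k * p x + p k * q x) = of_int (p k) * s q - of_int (q k) * s p"
      by (simp add: s_def sum_distrib_left algebra_simps flip: sum_subtractf)
    moreover have "real_of_int (p k) > 0" "real_of_int (q k) < 0"
      using that by (auto simp: Tp_def Tn_def)
    ultimately show ?thesis
      by (auto simp: bnd_def field_simps split: if_splits)
  qed
  obtain t where t: "\<And>p a. (p, a) \<in> Tp \<Longrightarrow> if a then bnd p < t else bnd p \<le> t"
    "\<And>q b. (q, b) \<in> Tn \<Longrightarrow> if b then t < bnd q else t \<le> bnd q"
  proof (rule real_between_finite_bounds[of "map_prod bnd id ` Tp" "map_prod bnd id ` Tn"], goal_cases)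
    case (3 l a u b)
    then show ?case using sep by auto
  next
    case (4 t)
    show ?case
    proof (rule 4(1))
      show "if a then bnd p < t else bnd p \<le> t" if "(p, a) \<in> Tp" for p a
        using 4(2)[of "bnd p" a] that by force
      show "if b then t < bnd q else t \<le> bnd q" if "(q, b) \<in> Tn" for q b
        using 4(3)[of "bnd q" b] that by force
    qed
  qed (use fin in auto)
  define w' where "w' = w(k := t)"
  have s': "(\<Sum>x\<in>insert k S. of_int (v x) * w' x) = of_int (v k) * t + s v" for v
    using insert.hyps by (auto simp: s_def w'_def intro!: sum.cong)
  show ?case
  proof (intro exI[of _ w'] allI impI)
    fix v b
    assume vb: "(v, b) \<in> T"
    consider "v k = 0" | "0 < v k" | "v k < 0" by linarith
    then show "if b then 0 < (\<Sum>x\<in>insert k S. of_int (v x) * w' x)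
        else 0 \<le> (\<Sum>x\<in>insert k S. of_int (v x) * w' x)"
    proof cases
      case 1
      then have "(v, b) \<in> T'" using vb by (simp add: T'_def T0_def)
      then show ?thesis using w 1 unfolding s' by (auto simp: s_def)
    next
      case 2
      then have "if b then bnd v < t else bnd v \<le> t" using t(1) vb by (auto simp: Tp_def)
      then show ?thesis using 2 unfolding s' by (auto simp: bnd_def field_simps split: if_splits)
    next
      case 3
      then have "if b then t < bnd v else t \<le> bnd v" using t(2) vb by (auto simp: Tn_def)
      then show ?thesis using 3 unfolding s' by (auto simp: bnd_def field_simps split: if_splits)
    qed
  qed
qed

text \<open>The system consists of all forms \<open>z + t - x - y\<close> over \<open>S\<close> that
  are positive, or at least nonnegative, in the group; there are finitely many. An equation is
  recovered from the two weak inequalities.\<close>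

lemma real_weights_exist:
  assumes S: "finite S" "S \<subseteq> carrier G"
  obtains w :: "'a \<Rightarrow> real"
  where "\<And>x y z t. \<lbrakk>x \<in> S; y \<in> S; z \<in> S; t \<in> S; x \<otimes> y = z \<otimes> t\<rbrakk> \<Longrightarrow> w x + w y = w z + w t"
    and "\<And>x y z t r. \<lbrakk>x \<in> S; y \<in> S; z \<in> S; t \<in> S; r \<in> P; r \<otimes> (x \<otimes> y) = z \<otimes> t\<rbrakk>
      \<Longrightarrow> w x + w y < w z + w t"
proof -
  define d where "d = (\<lambda>z i :: 'a. if i = z then 1 else 0 :: int)"
  \<comment> \<open>Summing indicator vectors keeps the coefficients right when some of the four
    elements coincide.\<close>
  define vec where "vec = (\<lambda>x y z t i. (d z i + d t i) + (- d x i - d y i))"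
  have lin: "r = lincomb S (vec x y z t)"
    if "x \<in> S" "y \<in> S" "z \<in> S" "t \<in> S" "r \<in> carrier G" "r \<otimes> (x \<otimes> y) = z \<otimes> t" for x y z t r
  proof -
    have cl: "x \<in> carrier G" "y \<in> carrier G" "z \<in> carrier G" "t \<in> carrier G"
      using that S by auto
    have dd: "lincomb S (\<lambda>i. d a i + d b i) = a \<otimes> b" if "a \<in> S" "b \<in> S" for a b
      using that S lincomb_delta by (simp add: lincomb_add d_def)
    have "lincomb S (vec x y z t) \<otimes> (x \<otimes> y) = lincomb S (\<lambda>i. vec x y z t i + (d x i + d y i))"
      using dd that S by (simp add: lincomb_add)
    also have "\<dots> = lincomb S (\<lambda>i. d z i + d t i)"
      by (simp add: vec_def)
    also have "\<dots> = r \<otimes> (x \<otimes> y)"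
      using dd that by simp
    finally show ?thesis
      using that cl S right_cancel[of "x \<otimes> y" r "lincomb S (vec x y z t)"] by simp
  qed
  define T where "T = (\<lambda>(b, x, y, z, t). (vec x y z t, b)) `
    {(b, x, y, z, t) \<in> UNIV \<times> S \<times> S \<times> S \<times> S. lincomb S (vec x y z t) \<in> sign_set b}"
  have "finite T"
    unfolding T_def
    by (rule finite_imageI, rule finite_subset[of _ "UNIV \<times> S \<times> S \<times> S \<times> S"]) (use S in auto)
  moreover have "lincomb S v \<in> sign_set b" if "(v, b) \<in> T" for v b
    using that by (auto simp: T_def)
  ultimately obtain w :: "'a \<Rightarrow> real" where w: "\<And>v b. (v, b) \<in> T \<Longrightarrow>
    (if b then 0 < (\<Sum>i\<in>S. of_int (v i) * w i) else 0 \<le> (\<Sum>i\<in>S. of_int (v i) * w i))"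
    using fourier_motzkin[OF S, of T] by blast
  have sum_d: "(\<Sum>i\<in>S. of_int (d z i) * w i) = w z" if "z \<in> S" for z
  proof -
    have "(\<Sum>i\<in>S. of_int (d z i) * w i) = (\<Sum>i\<in>S. if i = z then w i else 0)"
      by (intro sum.cong) (auto simp: d_def)
    then show ?thesis using that S by simp
  qed
  have val: "if b then w x + w y < w z + w t else w x + w y \<le> w z + w t"
    if "x \<in> S" "y \<in> S" "z \<in> S" "t \<in> S" "r \<in> sign_set b" "r \<otimes> (x \<otimes> y) = z \<otimes> t" for b x y z t r
  proof -
    have "(vec x y z t, b) \<in> T"
      using that lin[of x y z t r] sign_set_subset[of b]
      unfolding T_def by (intro image_eqI[of _ _ "(b, x, y, z, t)"]) auto
    moreover have "(\<Sum>i\<in>S. of_int (vec x y z t i) * w i) = w z + w t - w x - w y"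
      using that sum_d by (simp add: vec_def distrib_right left_diff_distrib sum.distrib sum_subtractf
          sum_negf)
    ultimately show ?thesis
      using w[of "vec x y z t" b] by (auto split: if_splits)
  qed
  have one: "\<one> \<in> sign_set False"
    by (simp add: sign_set_def)
  show thesis
  proof (rule that[of w])
    show "w x + w y = w z + w t"
      if "x \<in> S" "y \<in> S" "z \<in> S" "t \<in> S" "x \<otimes> y = z \<otimes> t" for x y z t
    proof -
      have "z \<otimes> t \<in> carrier G"
        using that S by auto
      then show ?thesis
        using val[of x y z t \<one> False] val[of z t x y \<one> False] that one by auto
    qed
    show "w x + w y < w z + w t"
      if "x \<in> S" "y \<in> S" "z \<in> S" "t \<in> S" "r \<in> P" "r \<otimes> (x \<otimes> y) = z \<otimes> t" for x y z t r
      using val[of x y z t r True] that by (simp add: sign_set_def)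
  qed
qed

end

section \<open>The ordered group of a chain\<close>

locale nontrivial_mv_chain = mv_chain +
  assumes one_neq_bot: "\<one> \<noteq> bot"
begin

text \<open>Totality compares \<open>y\<close> with \<open>neg x\<close>: above it the sum is
  \<open>\<one>\<close>, below it the product is \<open>bot\<close>.\<close>

lemma plus_neq_one_mult: "\<lbrakk>x \<in> carrier A; y \<in> carrier A; x \<boxplus> y \<noteq> \<one>\<rbrakk> \<Longrightarrow> x \<otimes> y = bot"
  using le_total[of "neg x" y] by (simp add: plus_eq_one_iff mult_eq_bot_iff m_comm[of x])

lemma mult_neq_one: "\<lbrakk>x \<in> carrier A; y \<in> carrier A; x \<noteq> \<one>\<rbrakk> \<Longrightarrow> x \<otimes> y \<noteq> \<one>"
  by (metis mult_le1 one_le_iff)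

text \<open>Chang's group of a chain: \<open>(m, a)\<close> stands for \<open>m u + a\<close> with \<open>0 \<le> a < u\<close>, added with carry.\<close>

definition chang_group :: "(int \<times> 'a) monoid" where
  "chang_group = \<lparr>carrier = UNIV \<times> (carrier A - {\<one>}),
     monoid.mult = (\<lambda>(m, a) (n, b). if a \<boxplus> b = \<one> then (m + n + 1, a \<otimes> b) else (m + n, a \<boxplus> b)),
     one = (0, bot)\<rparr>"

lemma chang_carrier [simp]: "(m, a) \<in> carrier chang_group \<longleftrightarrow> a \<in> carrier A \<and> a \<noteq> \<one>"
  and chang_mult: "(m, a) \<otimes>\<^bsub>chang_group\<^esub> (n, b) =
    (if a \<boxplus> b = \<one> then (m + n + 1, a \<otimes> b) else (m + n, a \<boxplus> b))"
  and chang_one: "\<one>\<^bsub>chang_group\<^esub> = (0, bot)"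
  by (auto simp: chang_group_def)

text \<open>The cases record which inner sums carry. The two sides always produce the same total
  carry, and the three carry identities match the remainders.\<close>

lemma chang_assoc:
  assumes cl: "a \<in> carrier A" "b \<in> carrier A" "c \<in> carrier A"
  shows "((m, a) \<otimes>\<^bsub>chang_group\<^esub> (n, b)) \<otimes>\<^bsub>chang_group\<^esub> (k, c) =
    (m, a) \<otimes>\<^bsub>chang_group\<^esub> ((n, b) \<otimes>\<^bsub>chang_group\<^esub> (k, c))"
proof -
  have exchange: "a \<boxplus> b \<boxplus> c = \<one> \<and> a \<boxplus> (b \<otimes> c) \<noteq> \<one> \<and> (a \<boxplus> b) \<otimes> c = a \<boxplus> (b \<otimes> c)"
    if "a \<in> carrier A" "b \<in> carrier A" "c \<in> carrier A" "a \<boxplus> b \<noteq> \<one>" "b \<boxplus> c = \<one>" for a b c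
  proof (intro conjI)
    show "a \<boxplus> b \<boxplus> c = \<one>" using that by (simp add: plus_assoc)
    show "(a \<boxplus> b) \<otimes> c = a \<boxplus> (b \<otimes> c)"
      using that by (intro plus_mult_exchange plus_neq_one_mult) auto
    have "a \<boxplus> (b \<otimes> c) \<preceq> a \<boxplus> b" using that by (simp add: plus_mono)
    then show "a \<boxplus> (b \<otimes> c) \<noteq> \<one>" using that by (auto simp: one_le_iff)
  qed
  consider "a \<boxplus> b \<noteq> \<one>" "b \<boxplus> c \<noteq> \<one>" | "a \<boxplus> b \<noteq> \<one>" "b \<boxplus> c = \<one>"
    | "a \<boxplus> b = \<one>" "b \<boxplus> c \<noteq> \<one>" | "a \<boxplus> b = \<one>" "b \<boxplus> c = \<one>" by blast
  then show ?thesis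
  proof cases
    case 1
    moreover have "(a \<boxplus> b) \<otimes> c = a \<otimes> (b \<boxplus> c)" if "a \<boxplus> b \<boxplus> c = \<one>"
      using 1 cl that by (simp add: plus_mult_assoc plus_neq_one_mult)
    ultimately show ?thesis
      using cl by (simp add: chang_mult plus_assoc)
  next
    case 2
    then show ?thesis
      using exchange[OF cl] cl by (simp add: chang_mult plus_assoc)
  next
    case 3
    then show ?thesis
      using exchange[of c b a] cl
      by (simp add: chang_mult plus_comm[of c b] plus_comm[of b a] plus_comm[of _ a] m_comm[of _ a]
          plus_comm[of c "a \<otimes> b"])
  next
    case 4
    \<comment> \<open>If both sides are \<open>\<one>\<close> there is nothing to prove. Otherwise
      one outer sum does not carry, so by totality the corresponding product, which is
      \<open>a \<otimes> b \<otimes> c\<close>, is \<open>bot\<close>.\<close>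
    have "a \<otimes> b \<boxplus> c = a \<boxplus> (b \<otimes> c)" if "a \<otimes> b \<boxplus> c \<noteq> \<one> \<or> a \<boxplus> (b \<otimes> c) \<noteq> \<one>"
    proof (rule mult_plus_assoc)
      show "a \<otimes> b \<otimes> c = bot"
        using that plus_neq_one_mult[of "a \<otimes> b" c] plus_neq_one_mult[of a "b \<otimes> c"] cl
        by (auto simp: m_assoc)
    qed (use 4 cl in auto)
    then have "a \<otimes> b \<boxplus> c = a \<boxplus> (b \<otimes> c)"
      by fastforce
    then show ?thesis
      using 4 cl by (simp add: chang_mult m_assoc)
  qed
qed

lemma comm_group_chang: "comm_group chang_group"
proof (rule comm_groupI)
  fix x y
  assume "x \<in> carrier chang_group" "y \<in> carrier chang_group"
  then show "x \<otimes>\<^bsub>chang_group\<^esub> y \<in> carrier chang_group"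
    and "x \<otimes>\<^bsub>chang_group\<^esub> y = y \<otimes>\<^bsub>chang_group\<^esub> x"
    by (cases x; cases y; auto simp: chang_mult mult_neq_one plus_comm m_comm)+
next
  fix x y z
  assume "x \<in> carrier chang_group" "y \<in> carrier chang_group" "z \<in> carrier chang_group"
  then show "x \<otimes>\<^bsub>chang_group\<^esub> y \<otimes>\<^bsub>chang_group\<^esub> z = x \<otimes>\<^bsub>chang_group\<^esub> (y \<otimes>\<^bsub>chang_group\<^esub> z)"
    by (cases x; cases y; cases z) (simp add: chang_assoc)
next
  fix x
  assume x: "x \<in> carrier chang_group"
  then show "\<one>\<^bsub>chang_group\<^esub> \<otimes>\<^bsub>chang_group\<^esub> x = x"
    by (cases x) (auto simp: chang_one chang_mult)
  obtain m a where ma: "x = (m, a)" "a \<in> carrier A" "a \<noteq> \<one>"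
    using x by (cases x) auto
  \<comment> \<open>The inverse of \<open>m u + a\<close> is \<open>(- m - 1) u + (u - a)\<close>.
    For \<open>a = bot\<close> this would have the excluded second component \<open>\<one>\<close>,
    so there the inverse is \<open>- m u\<close>.\<close>
  show "\<exists>y\<in>carrier chang_group. y \<otimes>\<^bsub>chang_group\<^esub> x = \<one>\<^bsub>chang_group\<^esub>"
  proof (cases "a = bot")
    case True
    then show ?thesis
      using ma one_neq_bot by (intro bexI[of _ "(- m, bot)"]) (auto simp: chang_one chang_mult)
  next
    case False
    then have "neg a \<noteq> \<one>" using ma by (metis neg_neg neg_one)
    moreover have "neg a \<boxplus> a = \<one>" "neg a \<otimes> a = bot"
      using ma by (simp_all add: plus_eq_one_iff mult_eq_bot_iff)
    ultimately show ?thesis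
      using ma by (intro bexI[of _ "(- m - 1, neg a)"]) (auto simp: chang_one chang_mult)
  qed
qed (use one_neq_bot in \<open>auto simp: chang_one\<close>)

definition chang_pos :: "(int \<times> 'a) set" where
  "chang_pos = {(m, a). a \<in> carrier A \<and> a \<noteq> \<one> \<and> 0 \<le> m \<and> (m, a) \<noteq> (0, bot)}"

lemma cone_group_chang: "cone_group chang_group chang_pos"
proof -
  interpret comm_group chang_group by (rule comm_group_chang)
  show ?thesis
  proof unfold_locales
    fix x y
    assume xy: "x \<in> chang_pos" "y \<in> chang_pos"
    then obtain m a n b where *: "x = (m, a)" "y = (n, b)" by (cases x; cases y)
    have "a \<boxplus> b \<noteq> bot" if "a \<noteq> bot"
      using that xy le_plus1[of a b] by (auto simp: * chang_pos_def le_bot_iff)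
    then show "x \<otimes>\<^bsub>chang_group\<^esub> y \<in> chang_pos"
      using xy by (auto simp: * chang_pos_def chang_mult mult_neq_one)
  qed (auto simp: chang_pos_def chang_one)
qed

definition chang_emb :: "'a \<Rightarrow> int \<times> 'a" where
  "chang_emb x = (if x = \<one> then (1, bot) else (0, x))"

lemma chang_emb_closed: "x \<in> carrier A \<Longrightarrow> chang_emb x \<in> carrier chang_group"
  using one_neq_bot by (auto simp: chang_emb_def)

lemma chang_emb_bot: "chang_emb bot = \<one>\<^bsub>chang_group\<^esub>"
  using one_neq_bot by (auto simp: chang_emb_def chang_one)

lemma chang_emb_pos: "\<lbrakk>x \<in> carrier A; x \<noteq> bot\<rbrakk> \<Longrightarrow> chang_emb x \<in> chang_pos"
  using one_neq_bot by (auto simp: chang_emb_def chang_pos_def)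

lemma chang_emb_mult:
  assumes "x \<in> carrier A" "y \<in> carrier A" "x \<boxplus> y = \<one>"
  shows "chang_emb x \<otimes>\<^bsub>chang_group\<^esub> chang_emb y =
    chang_emb \<one> \<otimes>\<^bsub>chang_group\<^esub> chang_emb (x \<otimes> y)"
  using assms one_neq_bot mult_neq_one[of x y]
  by (auto simp: chang_emb_def chang_mult)

text \<open>Additively, \<open>y + (u - x) = u + (y \<otimes> neg x)\<close> and
  \<open>x + (u - x) = u\<close>; cancelling \<open>u - x\<close> shows that
  \<open>y \<otimes> neg x\<close> is the difference \<open>y - x\<close>. It is the positive
  element that witnesses \<open>x < y\<close>.\<close>

lemma chang_emb_diff:
  assumes xy: "x \<in> carrier A" "y \<in> carrier A" "x \<preceq> y"
  shows "chang_emb (y \<otimes> neg x) \<otimes>\<^bsub>chang_group\<^esub> chang_emb x = chang_emb y"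
proof -
  interpret G: comm_group chang_group by (rule comm_group_chang)
  let ?e = chang_emb
  have cl: "?e x \<in> carrier chang_group" "?e y \<in> carrier chang_group"
    "?e (neg x) \<in> carrier chang_group" "?e (y \<otimes> neg x) \<in> carrier chang_group"
    "?e \<one> \<in> carrier chang_group"
    using xy by (simp_all add: chang_emb_closed)
  have "x \<boxplus> neg x = \<one>" "x \<otimes> neg x = bot" "y \<boxplus> neg x = \<one>"
    using xy by (simp_all add: plus_eq_one_iff mult_eq_bot_iff neg_le_neg)
  then have 1: "?e x \<otimes>\<^bsub>chang_group\<^esub> ?e (neg x) = ?e \<one>"
    and 2: "?e y \<otimes>\<^bsub>chang_group\<^esub> ?e (neg x) = ?e \<one> \<otimes>\<^bsub>chang_group\<^esub> ?e (y \<otimes> neg x)"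
    using chang_emb_mult[of x "neg x"] chang_emb_mult[of y "neg x"] xy cl
    by (simp_all add: chang_emb_bot)
  have "(?e (y \<otimes> neg x) \<otimes>\<^bsub>chang_group\<^esub> ?e x) \<otimes>\<^bsub>chang_group\<^esub> ?e (neg x) =
      ?e (y \<otimes> neg x) \<otimes>\<^bsub>chang_group\<^esub> ?e \<one>"
    using cl by (simp add: G.m_assoc 1)
  also have "\<dots> = ?e y \<otimes>\<^bsub>chang_group\<^esub> ?e (neg x)"
    unfolding 2 using cl by (simp add: G.m_comm)
  finally show ?thesis
    using cl by simp
qed

lemma real_partial_embedding:
  assumes S: "finite S" "S \<subseteq> carrier A"
  obtains h :: "'a \<Rightarrow> real" where "h \<in> S \<rightarrow> {0..1}" "h \<one> = 1"
    "\<And>x y. \<lbrakk>x \<in> S; y \<in> S; x \<preceq> y; x \<noteq> y\<rbrakk> \<Longrightarrow> h x < h y"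
    "\<And>x y. \<lbrakk>x \<in> S; y \<in> S; x \<otimes> y \<in> S\<rbrakk> \<Longrightarrow> h (x \<otimes> y) = luk_prod (h x) (h y)"
    "\<And>x y. \<lbrakk>x \<in> S; y \<in> S; imp A x y \<in> S\<rbrakk> \<Longrightarrow> h (imp A x y) = min 1 (1 - h x + h y)"
proof -
  interpret G: cone_group chang_group chang_pos by (rule cone_group_chang)
  let ?e = chang_emb
  \<comment> \<open>\<open>bot\<close> pads relations that have fewer than four terms; together with
    \<open>\<one>\<close> it also fixes the scale of \<open>h\<close>.\<close>
  define S' where "S' = insert bot (insert \<one> S)"
  have S': "finite S'" "S' \<subseteq> carrier A" "S \<subseteq> S'" "bot \<in> S'" "\<one> \<in> S'"
    using S by (auto simp: S'_def)
  have cl: "?e x \<in> carrier chang_group" if "x \<in> S'" for x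
    using that S'(2) chang_emb_closed by blast
  have img: "finite (?e ` S')" "?e ` S' \<subseteq> carrier chang_group"
    using S'(1) cl by blast+
  obtain w :: "int \<times> 'a \<Rightarrow> real"
    where w_eq: "\<And>x y z t. \<lbrakk>x \<in> ?e ` S'; y \<in> ?e ` S'; z \<in> ?e ` S'; t \<in> ?e ` S';
        x \<otimes>\<^bsub>chang_group\<^esub> y = z \<otimes>\<^bsub>chang_group\<^esub> t\<rbrakk> \<Longrightarrow> w x + w y = w z + w t"
      and w_less: "\<And>x y z t r. \<lbrakk>x \<in> ?e ` S'; y \<in> ?e ` S'; z \<in> ?e ` S'; t \<in> ?e ` S'; r \<in> chang_pos;
        r \<otimes>\<^bsub>chang_group\<^esub> (x \<otimes>\<^bsub>chang_group\<^esub> y) = z \<otimes>\<^bsub>chang_group\<^esub> t\<rbrakk> \<Longrightarrow> w x + w y < w z + w t"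
  proof (rule G.real_weights_exist[OF img], goal_cases)
    case (1 w)
    from 1(2,3) show ?case by (rule 1(1))
  qed
  have one_img: "\<one>\<^bsub>chang_group\<^esub> \<in> ?e ` S'"
    using S'(4) unfolding chang_emb_bot[symmetric] by (rule imageI)
  define g where "g x = w (?e x)" for x
  have g_mult: "g x + g y = g \<one> + g (x \<otimes> y)"
    if "x \<in> S'" "y \<in> S'" "x \<otimes> y \<in> S'" "x \<boxplus> y = \<one>" for x y
    using that S' w_eq[of "?e x" "?e y" "?e \<one>" "?e (x \<otimes> y)"] chang_emb_mult[of x y]
    by (auto simp: g_def)
  have g_less: "g x < g y" if xy: "x \<in> S'" "y \<in> S'" "x \<preceq> y" "x \<noteq> y" for x y
  proof -
    have xyA: "x \<in> carrier A" "y \<in> carrier A" using xy S' by auto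
    then have "\<not> y \<preceq> x"
      using xy le_antisym by blast
    then have "y \<otimes> neg x \<noteq> bot"
      using xyA by (simp add: mult_eq_bot_iff)
    then have "?e (y \<otimes> neg x) \<in> chang_pos"
      using xyA by (simp add: chang_emb_pos)
    then show ?thesis
      using w_less[of "?e x" "?e bot" "?e y" "?e bot" "?e (y \<otimes> neg x)"] xy S' cl one_img
        chang_emb_diff[OF xyA xy(3)] by (simp add: g_def chang_emb_bot)
  qed
  have g_plus: "g x + g y < g \<one> + g bot" if xy: "x \<in> S'" "y \<in> S'" "x \<boxplus> y \<noteq> \<one>" for x y
  proof -
    have xyA: "x \<in> carrier A" "y \<in> carrier A" using xy S' by auto
    have ny: "y \<preceq> neg x"
      using xyA plus_neq_one_mult[of x y] xy mult_eq_bot_iff[of y x] by (simp add: m_comm)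
    \<comment> \<open>The gap \<open>u - x - y\<close>, nonzero because the sum does not reach
      \<open>\<one>\<close>.\<close>
    define r where "r = neg x \<otimes> neg y"
    have "r \<noteq> bot"
    proof
      assume "r = bot"
      then have "neg (x \<boxplus> y) = bot" using xyA by (simp add: r_def neg_plus)
      then show False using xyA xy by (metis neg_bot neg_neg plus_closed)
    qed
    then have "?e r \<in> chang_pos"
      using xyA by (simp add: chang_emb_pos r_def)
    moreover have "?e r \<otimes>\<^bsub>chang_group\<^esub> (?e x \<otimes>\<^bsub>chang_group\<^esub> ?e y) = ?e \<one>"
    proof -
      have "?e r \<in> carrier chang_group"
        using xyA by (simp add: chang_emb_closed r_def)
      then have "?e r \<otimes>\<^bsub>chang_group\<^esub> (?e x \<otimes>\<^bsub>chang_group\<^esub> ?e y) = ?e x \<otimes>\<^bsub>chang_group\<^esub> ?e (neg x)"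
        using chang_emb_diff[of y "neg x"] xyA ny cl[OF xy(1)] cl[OF xy(2)]
        by (simp add: G.m_lcomm r_def)
      also have "\<dots> = ?e \<one>"
        using chang_emb_mult[of x "neg x"] xyA cl[OF \<open>\<one> \<in> S'\<close>]
        by (simp add: plus_eq_one_iff mult_eq_bot_iff[THEN iffD2] chang_emb_bot)
      finally show ?thesis .
    qed
    ultimately show ?thesis
      using w_less[of "?e x" "?e y" "?e \<one>" "?e bot" "?e r"] xy S' cl one_img
      by (simp add: g_def chang_emb_bot)
  qed
  \<comment> \<open>The relations between weights have two terms on each side, so they survive
    adding a constant and positive scaling. Hence \<open>g bot\<close> and \<open>g \<one>\<close>
    are not determined, and an affine change moves them to 0 and 1.\<close>
  define D where "D = g \<one> - g bot"
  have pos: "0 < D"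
    using g_less[of bot \<one>] S' one_neq_bot by (simp add: D_def)
  define h where "h x = (g x - g bot) / D" for x
  have hD: "h x * D = g x - g bot" for x
    using pos by (simp add: h_def)
  have h_less: "h x < h y" if "x \<in> S'" "y \<in> S'" "x \<preceq> y" "x \<noteq> y" for x y
    using g_less[OF that] pos by (simp add: h_def divide_strict_right_mono)
  have h_le: "h x \<le> h y" if "x \<in> S'" "y \<in> S'" "x \<preceq> y" for x y
    using h_less[of x y] that by (cases "x = y") auto
  have h01: "h \<one> = 1" "h bot = 0"
    using pos by (simp_all add: h_def flip: D_def)
  have range: "0 \<le> h x" "h x \<le> 1" if "x \<in> S'" for x
    using h_le[of bot x] h_le[of x \<one>] that S' h01 by auto
  have h_mult: "h x + h y = 1 + h (x \<otimes> y)"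
    if "x \<in> S'" "y \<in> S'" "x \<otimes> y \<in> S'" "x \<boxplus> y = \<one>" for x y
  proof -
    have "(h x + h y) * D = (1 + h (x \<otimes> y)) * D"
      using g_mult[OF that] by (simp add: distrib_right hD) (simp add: D_def)
    then show ?thesis
      using pos by simp
  qed
  show thesis
  proof (rule that[of h])
    show "h \<in> S \<rightarrow> {0..1}" using range S' by auto
    show "h \<one> = 1" by (rule h01)
    show "h x < h y" if "x \<in> S" "y \<in> S" "x \<preceq> y" "x \<noteq> y" for x y
      using h_less that S' by auto
    show "h (x \<otimes> y) = luk_prod (h x) (h y)" if "x \<in> S" "y \<in> S" "x \<otimes> y \<in> S" for x y
    proof -
      have xy: "x \<in> S'" "y \<in> S'" "x \<otimes> y \<in> S'" using that S' by auto
      show ?thesis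
      proof (cases "x \<boxplus> y = \<one>")
        case True
        then show ?thesis
          using h_mult[OF xy True] range[OF xy(3)] by (simp add: luk_prod_def)
      next
        case False
        then have "x \<otimes> y = bot"
          using xy S' by (intro plus_neq_one_mult) auto
        moreover have "h x + h y < 1"
        proof -
          have "(h x + h y) * D < 1 * D"
            using g_plus[OF xy(1,2) False] by (simp add: distrib_right hD) (simp add: D_def)
          then show ?thesis
            using pos by simp
        qed
        ultimately show ?thesis
          using h01 by (simp add: luk_prod_def)
      qed
    qed
    show "h (imp A x y) = min 1 (1 - h x + h y)" if "x \<in> S" "y \<in> S" "imp A x y \<in> S" for x y
    proof -
      have xy: "x \<in> S'" "y \<in> S'" "imp A x y \<in> S'" using that S' by auto
      then have xyA: "x \<in> carrier A" "y \<in> carrier A" using S' by auto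
      show ?thesis
      proof (cases "x \<preceq> y")
        case True
        then show ?thesis
          using h_le[OF xy(1,2)] xyA h01 imp_eq_one_iff[of x y] by simp
      next
        case False
        then have "y \<preceq> x" using le_total xyA by blast
        \<comment> \<open>The implication is now an untruncated difference: its product with
          \<open>x\<close> is \<open>y\<close> and its sum with \<open>x\<close> reaches
          \<open>\<one>\<close>, so the linear equation for products applies.\<close>
        then have 1: "imp A x y \<otimes> x = y"
          using mult_imp_cancel xyA by (simp add: m_comm)
        have "imp A x y \<boxplus> x = \<one>"
          using xyA le_plus1[of "neg x" y]
          by (simp add: imp_eq_plus plus_comm[of _ x] plus_eq_one_iff)
        then have "h (imp A x y) + h x = 1 + h y"
          using h_mult[of "imp A x y" x] xy 1 by simp
        then show ?thesis
          using range[OF xy(3)] by simp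
      qed
    qed
  qed
qed

end

section \<open>Completeness of the standard MV-algebra\<close>

lemma l0_hom_FmD:
  assumes "e \<in> l0_hom Fm B"
  shows "e s \<in> carrier B" "e (Meet s t) = meet B (e s) (e t)" "e (Join s t) = join B (e s) (e t)"
    "e (Times s t) = e s \<otimes>\<^bsub>B\<^esub> e t" "e (Imp s t) = imp B (e s) (e t)" "e Unit = \<one>\<^bsub>B\<^esub>"
  using assms by (auto simp: l0_hom_def Fm_def)

lemma l0_hom_FmI:
  assumes "\<And>s. e s \<in> carrier B"
    "\<And>s t. e (Meet s t) = meet B (e s) (e t)" "\<And>s t. e (Join s t) = join B (e s) (e t)"
    "\<And>s t. e (Times s t) = e s \<otimes>\<^bsub>B\<^esub> e t" "\<And>s t. e (Imp s t) = imp B (e s) (e t)"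
    "e Unit = \<one>\<^bsub>B\<^esub>"
  shows "e \<in> l0_hom Fm B"
  using assms by (auto simp: l0_hom_def Fm_def)

lemma l0_hom_comp:
  assumes "e \<in> l0_hom Fm A" "h \<in> l0_hom A B"
  shows "h \<circ> e \<in> l0_hom Fm B"
  using l0_hom_FmD[OF assms(1)] assms(2) by (intro l0_hom_FmI) (auto simp: l0_hom_def)

primrec fm_eval :: "'b l0_algebra \<Rightarrow> (nat \<Rightarrow> 'b) \<Rightarrow> fm \<Rightarrow> 'b" where
  "fm_eval B v (Var n) = v n"
| "fm_eval B v (Meet s t) = meet B (fm_eval B v s) (fm_eval B v t)"
| "fm_eval B v (Join s t) = join B (fm_eval B v s) (fm_eval B v t)"
| "fm_eval B v (Times s t) = fm_eval B v s \<otimes>\<^bsub>B\<^esub> fm_eval B v t"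
| "fm_eval B v (Imp s t) = imp B (fm_eval B v s) (fm_eval B v t)"
| "fm_eval B v Unit = \<one>\<^bsub>B\<^esub>"

lemma (in mv_algebra) fm_eval_hom:
  assumes "\<And>n. v n \<in> carrier A"
  shows "fm_eval A v \<in> l0_hom Fm A"
proof -
  have "fm_eval A v s \<in> carrier A" for s
    using assms by (induction s) auto
  then show ?thesis by (intro l0_hom_FmI) auto
qed

lemma std_MV_simps [simp]:
  "carrier std_MV = {0..1}" "x \<otimes>\<^bsub>std_MV\<^esub> y = luk_prod x y" "\<one>\<^bsub>std_MV\<^esub> = 1"
  "meet std_MV x y = min x y" "join std_MV x y = max x y" "imp std_MV x y = min 1 (1 - x + y)"
  by (simp_all add: std_MV_def)

lemma l0_le_std_MV [simp]: "l0_le std_MV x y \<longleftrightarrow> x \<le> y"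
  by (auto simp: l0_le_def)

primrec subfms :: "fm \<Rightarrow> fm set" where
  "subfms (Var n) = {Var n}"
| "subfms (Meet s t) = insert (Meet s t) (subfms s \<union> subfms t)"
| "subfms (Join s t) = insert (Join s t) (subfms s \<union> subfms t)"
| "subfms (Times s t) = insert (Times s t) (subfms s \<union> subfms t)"
| "subfms (Imp s t) = insert (Imp s t) (subfms s \<union> subfms t)"
| "subfms Unit = {Unit}"

lemma finite_subfms: "finite (subfms s)"
  by (induction s) auto

lemma subfms_refl: "s \<in> subfms s"
  by (cases s) auto

lemma (in nontrivial_mv_chain) std_MV_refutation:
  assumes e: "e \<in> l0_hom Fm A" and st: "\<not> e s \<preceq> e t"
  obtains e' where "e' \<in> l0_hom Fm std_MV" "\<not> e' s \<le> e' t"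
proof -
  interpret std: mv_algebra std_MV by (rule mv_algebra_std_MV)
  define S where "S = e ` (subfms s \<union> subfms t)"
  have S: "finite S" "S \<subseteq> carrier A"
    using l0_hom_FmD(1)[OF e] by (auto simp: S_def finite_subfms)
  obtain h :: "'a \<Rightarrow> real" where h: "h \<in> S \<rightarrow> {0..1}" "h \<one> = 1"
    and h_less: "\<And>x y. \<lbrakk>x \<in> S; y \<in> S; x \<preceq> y; x \<noteq> y\<rbrakk> \<Longrightarrow> h x < h y"
    and h_mult: "\<And>x y. \<lbrakk>x \<in> S; y \<in> S; x \<otimes> y \<in> S\<rbrakk> \<Longrightarrow> h (x \<otimes> y) = luk_prod (h x) (h y)"
    and h_imp: "\<And>x y. \<lbrakk>x \<in> S; y \<in> S; imp A x y \<in> S\<rbrakk> \<Longrightarrow> h (imp A x y) = min 1 (1 - h x + h y)"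
  proof (rule real_partial_embedding[OF S], goal_cases)
    case (1 h)
    from 1(2-) show ?case by (rule 1(1))
  qed
  \<comment> \<open>In a chain meet and join each return one of their arguments, so they are
    preserved because \<open>h\<close> is increasing on \<open>S\<close>.\<close>
  have h_meet: "h (meet A x y) = min (h x) (h y)" and h_join: "h (join A x y) = max (h x) (h y)"
    if xy: "x \<in> S" "y \<in> S" for x y
  proof -
    have xyA: "x \<in> carrier A" "y \<in> carrier A" using xy S by auto
    have "h x \<le> h y \<and> meet A x y = x \<and> join A x y = y \<or> h y \<le> h x \<and> meet A x y = y \<and> join A x y = x"
    proof (cases "x \<preceq> y")
      case True
      then have "meet A x y = x" "join A x y = y"
        using xyA le_iff_join[of x y] by (simp_all add: l0_le_def)
      then show ?thesis
        using h_less[OF xy True] by (cases "x = y") auto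
    next
      case False
      then have yx: "y \<preceq> x" using le_total xyA by blast
      then have "meet A x y = y" "join A x y = x"
        using xyA le_iff_join[of y x] meet_comm[of x y] join_comm[of x y]
        by (simp_all add: l0_le_def)
      then show ?thesis
        using h_less[OF xy(2,1) yx] by (cases "x = y") auto
    qed
    then show "h (meet A x y) = min (h x) (h y)" "h (join A x y) = max (h x) (h y)"
      by auto
  qed
  \<comment> \<open>A variable whose value lies outside \<open>S\<close> occurs in neither formula;
    the default 0 merely keeps \<open>v\<close> inside [0,1].\<close>
  define v where "v n = (if e (Var n) \<in> S then h (e (Var n)) else 0)" for n
  have "v n \<in> carrier std_MV" for n
    using h(1) by (auto simp: v_def)
  then have hom: "fm_eval std_MV v \<in> l0_hom Fm std_MV"
    by (rule std.fm_eval_hom)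
  have val: "fm_eval std_MV v p = h (e p)" if "\<forall>q\<in>subfms p. e q \<in> S" for p
    using that
  proof (induction p)
    case (Meet p q)
    then show ?case
      using subfms_refl[of p] subfms_refl[of q] by (auto simp: l0_hom_FmD[OF e] h_meet)
  next
    case (Join p q)
    then show ?case
      using subfms_refl[of p] subfms_refl[of q] by (auto simp: l0_hom_FmD[OF e] h_join)
  next
    case (Times p q)
    then show ?case
      using subfms_refl[of p] subfms_refl[of q] by (auto simp: l0_hom_FmD[OF e] h_mult)
  next
    case (Imp p q)
    then show ?case
      using subfms_refl[of p] subfms_refl[of q] by (auto simp: l0_hom_FmD[OF e] h_imp)
  qed (auto simp: l0_hom_FmD[OF e] h v_def)
  have stS: "e s \<in> S" "e t \<in> S"
    using subfms_refl[of s] subfms_refl[of t] by (auto simp: S_def)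
  moreover have "e t \<preceq> e s" "e t \<noteq> e s"
    using le_total[of "e s" "e t"] st l0_hom_FmD(1)[OF e] by auto
  ultimately have "h (e t) < h (e s)"
    by (intro h_less)
  then have "\<not> fm_eval std_MV v s \<le> fm_eval std_MV v t"
    using val[of s] val[of t] by (auto simp: S_def)
  then show thesis
    using that hom by blast
qed

lemma (in mv_algebra) chang_completeness:
  assumes "\<forall>e\<in>l0_hom Fm std_MV. e s \<le> e t" and e: "e \<in> l0_hom Fm A"
  shows "e s \<preceq> e t"
proof (rule ccontr)
  assume "\<not> e s \<preceq> e t"
  then obtain B :: "'a l0_algebra" and h
    where "mv_chain B" and h: "h \<in> l0_hom A B" and hst: "\<not> l0_le B (h (e s)) (h (e t))"
    using mv_chain_separation l0_hom_FmD(1)[OF e] by blast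
  interpret B: mv_chain B by fact
  have he: "h \<circ> e \<in> l0_hom Fm B"
    using e h by (rule l0_hom_comp)
  \<comment> \<open>In a one-element chain every inequality holds, so the separated pair excludes
    it.\<close>
  interpret B: nontrivial_mv_chain B
  proof
    show "\<one>\<^bsub>B\<^esub> \<noteq> B.bot"
    proof
      assume "\<one>\<^bsub>B\<^esub> = B.bot"
      then have "h (e s) = \<one>\<^bsub>B\<^esub>" "h (e t) = \<one>\<^bsub>B\<^esub>"
        using l0_hom_FmD(1)[OF he, of s] l0_hom_FmD(1)[OF he, of t]
          B.bot_le[of "h (e s)"] B.bot_le[of "h (e t)"] B.one_le_iff[of "h (e s)"]
          B.one_le_iff[of "h (e t)"] by simp_all
      then show False
        using hst by simp
    qed
  qed
  obtain e' where "e' \<in> l0_hom Fm std_MV" "\<not> e' s \<le> e' t"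
    using B.std_MV_refutation[OF he] hst by auto
  then show False
    using assms(1) by blast
qed

section \<open>Transfer of refutations to an arbitrary infinite type\<close>

instance fm :: countable
  by countable_datatype

text \<open>Transport of structure along \<open>g\<close>, with \<open>k\<close> as its inverse on
  \<open>R\<close>. The least element \<open>z\<close> is asked for separately because closure under
  the operations of the signature does not provide one.\<close>

lemma (in mv_algebra) mv_algebra_copy:
  fixes g :: "'a \<Rightarrow> 'b" and k :: "'b \<Rightarrow> 'a"
  assumes R: "R \<subseteq> carrier A" and kg: "\<And>x. x \<in> R \<Longrightarrow> k (g x) = x"
    and "\<one> \<in> R" "\<And>x y. \<lbrakk>x \<in> R; y \<in> R\<rbrakk> \<Longrightarrow>
      x \<otimes> y \<in> R \<and> meet A x y \<in> R \<and> join A x y \<in> R \<and> imp A x y \<in> R"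
    and z: "z \<in> R" "\<And>x. x \<in> R \<Longrightarrow> z \<preceq> x"
  defines "B \<equiv> \<lparr>carrier = g ` R, monoid.mult = (\<lambda>x y. g (k x \<otimes> k y)), one = g \<one>,
    meet = (\<lambda>x y. g (meet A (k x) (k y))), join = (\<lambda>x y. g (join A (k x) (k y))),
    imp = (\<lambda>x y. g (imp A (k x) (k y)))\<rparr>"
  shows "mv_algebra B" "\<And>x y. \<lbrakk>x \<in> R; y \<in> R\<rbrakk> \<Longrightarrow> l0_le B (g x) (g y) \<longleftrightarrow> x \<preceq> y"
proof -
  have RA: "x \<in> carrier A" if "x \<in> R" for x
    using that R by auto
  have cl [simp]: "\<one> \<in> R" "\<And>x y. \<lbrakk>x \<in> R; y \<in> R\<rbrakk> \<Longrightarrow> x \<otimes> y \<in> R"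
    "\<And>x y. \<lbrakk>x \<in> R; y \<in> R\<rbrakk> \<Longrightarrow> meet A x y \<in> R" "\<And>x y. \<lbrakk>x \<in> R; y \<in> R\<rbrakk> \<Longrightarrow> join A x y \<in> R"
    "\<And>x y. \<lbrakk>x \<in> R; y \<in> R\<rbrakk> \<Longrightarrow> imp A x y \<in> R"
    using assms by auto
  have sel [simp]: "carrier B = g ` R" "x \<otimes>\<^bsub>B\<^esub> y = g (k x \<otimes> k y)" "\<one>\<^bsub>B\<^esub> = g \<one>"
    "meet B x y = g (meet A (k x) (k y))" "join B x y = g (join A (k x) (k y))"
    "imp B x y = g (imp A (k x) (k y))" for x y
    by (simp_all add: B_def)
  show le: "l0_le B (g x) (g y) \<longleftrightarrow> x \<preceq> y" if "x \<in> R" "y \<in> R" for x y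
  proof -
    have "g (meet A x y) = g x \<longleftrightarrow> meet A x y = x"
      using that kg cl(3) by metis
    then show ?thesis
      using that by (simp add: l0_le_def kg)
  qed
  show "mv_algebra B"
  proof (unfold_locales, goal_cases)
    case 2
    then show ?case by (auto simp: kg RA m_assoc)
  next
    case 12
    then show ?case by (auto simp: kg RA meet_assoc)
  next
    case 13
    then show ?case by (auto simp: kg RA join_assoc)
  next
    case (16 x y z)
    then show ?case
      by (auto simp: le kg RA residuation)
  next
    case (17 x)
    then show ?case
      by (auto simp: le RA)
  next
    case 18
    show ?case
      using z by (auto simp: le)
  qed (auto simp: kg RA m_comm meet_comm join_comm meet_absorb join_absorb imp_imp)
qed

lemma MV_valid_le_iff_std_MV:
  assumes inf: "infinite (UNIV :: 'a set)"
  shows "MV_valid_le TYPE('a) s t \<longleftrightarrow> (\<forall>e\<in>l0_hom Fm std_MV. e s \<le> e t)"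
proof
  assume "\<forall>e\<in>l0_hom Fm std_MV. e s \<le> e t"
  then show "MV_valid_le TYPE('a) s t"
    unfolding MV_valid_le_def using mv_algebra.chang_completeness by blast
next
  assume valid: "MV_valid_le TYPE('a) s t"
  show "\<forall>e\<in>l0_hom Fm std_MV. e s \<le> e t"
  proof
    fix e
    assume e: "e \<in> l0_hom Fm std_MV"
    interpret std: mv_algebra std_MV by (rule mv_algebra_std_MV)
    \<comment> \<open>The extra variable of value \<open>0\<close> ensures that the subalgebra \<open>R\<close> has a least element.\<close>
    define v where "v n = (case n of 0 \<Rightarrow> 0 | Suc m \<Rightarrow> e (Var m))" for n
    define E where "E = fm_eval std_MV v"
    define R where "R = range E"
    have "v n \<in> carrier std_MV" for n
      using l0_hom_FmD(1)[OF e] by (auto simp: v_def split: nat.split)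
    then have E: "E \<in> l0_hom Fm std_MV"
      unfolding E_def by (rule std.fm_eval_hom)
    note E_simps = l0_hom_FmD(2-6)[OF E, symmetric]
    have R: "R \<subseteq> carrier std_MV"
      using l0_hom_FmD(1)[OF E] unfolding R_def by blast
    have R_one: "\<one>\<^bsub>std_MV\<^esub> \<in> R"
      unfolding R_def E_simps by blast
    have R_ops: "x \<otimes>\<^bsub>std_MV\<^esub> y \<in> R \<and> meet std_MV x y \<in> R \<and> join std_MV x y \<in> R \<and> imp std_MV x y \<in> R"
      if xy: "x \<in> R" "y \<in> R" for x y
    proof -
      from xy obtain p q where "x = E p" "y = E q" by (auto simp: R_def)
      then show ?thesis unfolding R_def by (simp only: E_simps) blast
    qed
    have "E (Var 0) = 0" by (simp add: E_def v_def)
    then have R_zero: "0 \<in> R" unfolding R_def by (metis rangeI)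
    have R_le: "l0_le std_MV 0 x" if "x \<in> R" for x
      using that R by auto
    have eR: "e p \<in> R" for p
    proof (induction p)
      case (Var n)
      have "E (Var (Suc n)) = e (Var n)" by (simp add: E_def v_def)
      then show ?case unfolding R_def by (metis rangeI)
    qed (use R_ops R_one in \<open>auto simp only: l0_hom_FmD[OF e]\<close>)
    obtain f :: "nat \<Rightarrow> 'a" where f: "inj f"
      using infinite_countable_subset[OF inf] by blast
    \<comment> \<open>Each element of \<open>R\<close> is the value of some formula; the code of one
      such formula is sent into \<open>'a\<close>. This is injective since formulas are countable
      and the value is recovered from the formula.\<close>
    define g where "g x = f (to_nat (inv_into UNIV E x))" for x
    define k where "k = inv_into R g"
    have "inj_on g R"
    proof (rule inj_onI)
      fix x y
      assume "x \<in> R" "y \<in> R" "g x = g y"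
      then show "x = y"
        using f by (auto simp: g_def R_def inj_eq dest: inv_into_injective)
    qed
    then have kg: "k (g x) = x" if "x \<in> R" for x
      using that by (simp add: k_def)
    let ?B = "\<lparr>carrier = g ` R, monoid.mult = (\<lambda>x y. g (k x \<otimes>\<^bsub>std_MV\<^esub> k y)), one = g \<one>\<^bsub>std_MV\<^esub>,
      meet = (\<lambda>x y. g (meet std_MV (k x) (k y))), join = (\<lambda>x y. g (join std_MV (k x) (k y))),
      imp = (\<lambda>x y. g (imp std_MV (k x) (k y)))\<rparr>"
    note copy = std.mv_algebra_copy[where R = R and g = g and k = k and z = 0, OF R kg R_one R_ops R_zero R_le]
    have "g \<circ> e \<in> l0_hom Fm ?B"
      using eR by (intro l0_hom_FmI) (simp_all only: l0_hom_FmD[OF e] l0_algebra.simps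
          monoid.simps partial_object.simps o_def kg imageI)
    then have "l0_le ?B ((g \<circ> e) s) ((g \<circ> e) t)"
      using valid copy(1) unfolding MV_valid_le_def by blast
    then show "e s \<le> e t"
      using copy(2)[of "e s" "e t"] eR by simp
  qed
qed

section \<open>Consequence relations on the unit interval\<close>

lemma luk_D_simps [simp]:
  "carrier luk_D = {0..1}" "x \<otimes>\<^bsub>luk_D\<^esub> y = luk_prod x y" "\<one>\<^bsub>luk_D\<^esub> = 1"
  by (simp_all add: luk_D_def)

lemma luk_prod_closed: "\<lbrakk>x \<in> {0..1}; y \<in> {0..1}\<rbrakk> \<Longrightarrow> luk_prod x y \<in> {0..1}"
  by (auto simp: luk_prod_def)

lemma luk_prod_mono: "y \<le> z \<Longrightarrow> luk_prod x y \<le> luk_prod x z"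
  by (auto simp: luk_prod_def)

lemma mset_prod_luk_D:
  assumes "set xs \<subseteq> {0..1}"
  shows "mset_prod luk_D (mset xs) = foldr luk_prod xs 1"
proof -
  have "(\<otimes>\<^bsub>luk_D\<^esub>) = luk_prod" by (intro ext) simp
  then show ?thesis
    using comm_monoid.mset_prod_mset[OF comm_monoid_luk_D, of xs] assms by simp
qed

lemma mset_prod_luk_D_empty: "mset_prod luk_D {#} = 1"
  using mset_prod_luk_D[of "[]"] by simp

lemma mset_prod_luk_D_add:
  assumes "x \<in> {0..1}" "X \<in> msets_over {0..1}"
  shows "mset_prod luk_D (add_mset x X) = luk_prod x (mset_prod luk_D X)"
proof -
  obtain xs where "X = mset xs" by (metis ex_mset)
  then show ?thesis
    using assms mset_prod_luk_D[of xs] mset_prod_luk_D[of "x # xs"] by (simp add: msets_over_def)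
qed

lemma mset_prod_luk_D_closed: "X \<in> msets_over {0..1} \<Longrightarrow> mset_prod luk_D X \<in> {0..1}"
proof (induction X)
  case (add x X)
  then have "x \<in> {0..1}" "X \<in> msets_over {0..1}"
    by (auto simp: msets_over_def)
  then show ?case
    using add.IH luk_prod_closed[of x] by (simp add: mset_prod_luk_D_add)
qed (simp add: mset_prod_luk_D_empty)

lemma mset_prod_luk_D_union_mono:
  assumes "C \<in> msets_over {0..1}" "X \<in> msets_over {0..1}" "Y \<in> msets_over {0..1}"
    and "mset_prod luk_D X \<le> mset_prod luk_D Y"
  shows "mset_prod luk_D (C + X) \<le> mset_prod luk_D (C + Y)"
  using assms(1)
proof (induction C)
  case (add c C)
  then have "c \<in> {0..1}" "C \<in> msets_over {0..1}" "C + X \<in> msets_over {0..1}"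
    "C + Y \<in> msets_over {0..1}"
    using assms by (auto simp: msets_over_def)
  then show ?case
    using add.IH by (simp add: mset_prod_luk_D_add luk_prod_mono)
qed (use assms in simp)

lemma mset_prod_luk_D_image:
  assumes f: "f \<in> {0..1} \<rightarrow> {0..1}" "f 1 = 1"
    "\<And>x y. \<lbrakk>x \<in> {0..1}; y \<in> {0..1}\<rbrakk> \<Longrightarrow> f (luk_prod x y) = luk_prod (f x) (f y)"
    and X: "X \<in> msets_over {0..1}"
  shows "mset_prod luk_D (image_mset f X) = f (mset_prod luk_D X)"
  using X
proof (induction X)
  case (add x X)
  then have X: "x \<in> {0..1}" "X \<in> msets_over {0..1}"
    by (auto simp: msets_over_def)
  moreover from this have "f x \<in> {0..1}" "image_mset f X \<in> msets_over {0..1}"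
    using f(1) by (fastforce simp: msets_over_def)+
  ultimately show ?case
    using add.IH f(3)[of x "mset_prod luk_D X"] mset_prod_luk_D_closed[of X]
    by (simp add: mset_prod_luk_D_add)
qed (simp add: mset_prod_luk_D_empty f)

text \<open>Since 1 is idempotent, so is its image, which is therefore 0 or 1; strict monotonicity
  puts it above \<open>f 0\<close>. This makes \<open>f\<close> respect the empty product.\<close>

lemma luk_prod_hom_one:
  assumes "f \<in> {0..1} \<rightarrow> {0..1}" "strict_mono_on {0..1} f"
    "\<And>x y. \<lbrakk>x \<in> {0..1}; y \<in> {0..1}\<rbrakk> \<Longrightarrow> f (luk_prod x y) = luk_prod (f x) (f y)"
  shows "f 1 = (1::real)"
proof -
  have "f 0 < f 1"
    using assms(2) by (simp add: strict_mono_on_def)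
  moreover have "0 \<le> f 0" "f 1 \<le> 1"
    using assms(1) by (auto simp: Pi_iff)
  moreover have "f 1 = luk_prod (f 1) (f 1)"
    using assms(3)[of 1 1] by (simp add: luk_prod_def)
  ultimately show ?thesis
    by (auto simp: luk_prod_def max_def split: if_splits)
qed

lemma l0_hom_foldr_Times:
  assumes e: "e \<in> l0_hom Fm std_MV"
  shows "e (foldr Times ps Unit) = mset_prod luk_D (image_mset e (mset ps))"
proof -
  have "e (foldr Times ps Unit) = foldr luk_prod (map e ps) 1"
    by (induction ps) (simp_all add: l0_hom_FmD[OF e])
  also have "\<dots> = mset_prod luk_D (mset (map e ps))"
    using l0_hom_FmD(1)[OF e] by (intro mset_prod_luk_D[symmetric]) auto
  finally show ?thesis by simp
qed

text \<open>The definition ranges over all enumerations of the multisets, but in [0,1] the folded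
  product depends only on the multiset, so one enumeration speaks for all.\<close>

lemma MV_entails_iff_std_MV:
  assumes "infinite (UNIV :: 'a set)"
  shows "MV_entails TYPE('a) \<Gamma> \<Delta> \<longleftrightarrow> (\<forall>e\<in>l0_hom Fm std_MV.
    mset_prod luk_D (image_mset e \<Gamma>) \<le> mset_prod luk_D (image_mset e \<Delta>))" (is "_ \<longleftrightarrow> ?R")
proof
  assume *: "MV_entails TYPE('a) \<Gamma> \<Delta>"
  obtain ps qs where "mset ps = \<Gamma>" "mset qs = \<Delta>" by (metis ex_mset)
  then show ?R
    using * unfolding MV_entails_def MV_valid_le_iff_std_MV[OF assms]
    by (metis l0_hom_foldr_Times)
next
  assume ?R
  then show "MV_entails TYPE('a) \<Gamma> \<Delta>"
    unfolding MV_entails_def MV_valid_le_iff_std_MV[OF assms] by (auto simp: l0_hom_foldr_Times)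
qed

lemma l0_hom_image_msets_over:
  "e \<in> l0_hom Fm std_MV \<Longrightarrow> image_mset e \<Gamma> \<in> msets_over {0..1}"
  using l0_hom_FmD(1)[of e std_MV] by (auto simp: msets_over_def)

text \<open>Multiplication by the entries of the context \<open>C\<close> is monotone, so the
  inequality passes to the enlarged multisets before \<open>f\<close> is applied, and
  \<open>{a..1}\<close> is closed under larger values in [0,1].\<close>

lemma class_M_sound:
  assumes le: "\<forall>e\<in>l0_hom Fm std_MV.
    mset_prod luk_D (image_mset e \<Gamma>) \<le> mset_prod luk_D (image_mset e \<Delta>)"
  shows "entails_star_class class_M \<Gamma> \<Delta>"
  unfolding entails_star_class_def
proof
  fix M
  assume "M \<in> class_M"
  then obtain a f where M: "M = (std_MV, luk_D, {a..1}, f)"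
    and f: "f \<in> {0..1} \<rightarrow> {0..1}" "strict_mono_on {0..1} f"
      "\<And>x y. \<lbrakk>x \<in> {0..1}; y \<in> {0..1}\<rbrakk> \<Longrightarrow> f (luk_prod x y) = luk_prod (f x) (f y)"
    unfolding class_M_def by blast
  have image: "mset_prod luk_D (image_mset f X) = f (mset_prod luk_D X)"
    if "X \<in> msets_over {0..1}" for X
    using mset_prod_luk_D_image[OF f(1) luk_prod_hom_one[OF f] f(3) that] .
  have mono: "f x \<le> f y" if "x \<in> {0..1}" "y \<in> {0..1}" "x \<le> y" for x y
    using that f(2) by (cases "x = y") (auto simp: strict_mono_on_def less_imp_le)
  have "mset_prod luk_D (image_mset f (C + image_mset e \<Delta>)) \<in> {a..1}"
    if C: "C \<in> msets_over {0..1}" and e: "e \<in> l0_hom Fm std_MV"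
      and a: "mset_prod luk_D (image_mset f (C + image_mset e \<Gamma>)) \<in> {a..1}" for C e
  proof -
    have over: "C + image_mset e X \<in> msets_over {0..1}" for X
      using C l0_hom_image_msets_over[OF e, of X] by (auto simp: msets_over_def)
    have "mset_prod luk_D (C + image_mset e \<Gamma>) \<le> mset_prod luk_D (C + image_mset e \<Delta>)"
      using C e le by (intro mset_prod_luk_D_union_mono l0_hom_image_msets_over) auto
    then have "f (mset_prod luk_D (C + image_mset e \<Gamma>)) \<le> f (mset_prod luk_D (C + image_mset e \<Delta>))"
      using over by (intro mono mset_prod_luk_D_closed)
    moreover have "f (mset_prod luk_D (C + image_mset e \<Delta>)) \<in> {0..1}"
      using f(1) mset_prod_luk_D_closed[OF over] by blast
    ultimately show ?thesis
      using a unfolding image[OF over] by simp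
  qed
  moreover have "C + image_mset e \<Delta> \<in> msets_over {0..1}"
    if "C \<in> msets_over {0..1}" "e \<in> l0_hom Fm std_MV" for C e
    using that l0_hom_image_msets_over[of e \<Delta>] by (auto simp: msets_over_def)
  ultimately show "entails_star M \<Gamma> \<Delta>"
    unfolding M entails_star.simps entails_matrix_def std_MV_simps by blast
qed

lemma class_I_complete:
  assumes I: "entails_star_class class_I \<Gamma> \<Delta>" and e: "e \<in> l0_hom Fm std_MV"
  shows "mset_prod luk_D (image_mset e \<Gamma>) \<le> mset_prod luk_D (image_mset e \<Delta>)"
proof -
  define a where "a = mset_prod luk_D (image_mset e \<Gamma>)"
  have a: "a \<in> {0..1}"
    unfolding a_def by (intro mset_prod_luk_D_closed l0_hom_image_msets_over e)
  have "(std_MV, luk_D, {a..1}, \<lambda>x. x) \<in> class_I"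
    using a by (auto simp: class_I_def class_M_def strict_mono_on_def)
  then have "entails_star (std_MV, luk_D, {a..1}, \<lambda>x. x) \<Gamma> \<Delta>"
    using I unfolding entails_star_class_def by blast
  \<comment> \<open>The empty context is enough: the threshold \<open>a\<close> already tests the
    bare inequality.\<close>
  moreover have "{#} \<in> msets_over (carrier std_MV)"
    by (simp add: msets_over_def)
  moreover have "{#} + image_mset e \<Gamma> \<in>
      {X \<in> msets_over (carrier std_MV). mset_prod luk_D (image_mset (\<lambda>x. x) X) \<in> {a..1}}"
    using a l0_hom_image_msets_over[OF e] by (simp add: a_def)
  ultimately have "{#} + image_mset e \<Delta> \<in>
      {X \<in> msets_over (carrier std_MV). mset_prod luk_D (image_mset (\<lambda>x. x) X) \<in> {a..1}}"
    using e unfolding entails_star.simps entails_matrix_def by blast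
  then show ?thesis
    by (simp add: a_def)
qed

text \<open>All three relations meet in the inequality between products in [0,1]. That
  \<open>'a\<close> is infinite serves to copy a refutation from [0,1] into
  \<open>'a\<close>.\<close>

theorem theorem5p23:
  fixes \<Gamma> \<Delta> :: "fm multiset"
  assumes "infinite (UNIV :: 'a set)"
  shows "(MV_entails TYPE('a) \<Gamma> \<Delta> \<longleftrightarrow> entails_star_class class_M \<Gamma> \<Delta>) \<and>
         (entails_star_class class_M \<Gamma> \<Delta> \<longleftrightarrow> entails_star_class class_I \<Gamma> \<Delta>)"
proof -
  have "entails_star_class class_I \<Gamma> \<Delta>" if "entails_star_class class_M \<Gamma> \<Delta>"
    using that unfolding entails_star_class_def class_I_def by blast
  then show ?thesis
    using class_M_sound class_I_complete MV_entails_iff_std_MV[OF assms] by blast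
qed

end
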